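(* Let $\mathtt{c}\in\mathbb{R}\setminus\{0\}$ and let $H(u)=\int_{\mathbb{T}}\big(\frac{\mathtt{c}\,u^2}{2}-\frac{u^3}{6}\big)\,dx$, with $x\in\mathbb{T}$. For any $N\in\mathbb{N}$ there exists, at least formally, a symplectic transformation $\Phi_N$ such that $$H\circ\Phi_N=H^{(0)}+Z_N+R_N,$$ where $Z_N\in\mathscr{P}^{(\le N)}$ is action-preserving, hence it Poisson commutes with $H^{(0)}$ and depends only on the actions $I_j:=|u_j|^2$, and $R_N\in\mathscr{F}^{(\geq N+1)}$.
   Context: Functions on $\mathbb{T}$ are real with zero average, written through their Fourier coefficients $u_j$, $j\in\mathbb{Z}\setminus\{0\}$, $\overline{u_j}=u_{-j}$ (so $u_0=0$ and only multi-indices with $\alpha_0=0$ are relevant). For $\alpha\in\mathbb{N}^{\mathbb{Z}}$ put $|\alpha|=\sum_j\alpha_j$, $u^\alpha=\prod_ju_j^{\alpha_j}$, $\mathcal{M}(\alpha)=\sum_jj\alpha_j$, and $\mathcal{I}_n=\{\alpha\in\mathbb{N}^{\mathbb{Z}}:|\alpha|=n+2,\ \mathcal{M}(\alpha)=0\}$. A formal homogeneous polynomial of degree $n+2$ is a family $P=(P_\alpha)_{\alpha\in\mathcal{I}_n}$, $P_\alpha\in\mathbb{C}$, written formally $P(u)=\sum_{\alpha\in\mathcal{I}_n}P_\alpha u^\alpha$; $\mathscr{P}^{(n)}$ is the space of these. $\mathscr{F}:=\prod_{n\geq0}\mathscr{P}^{(n)}$ is the space of formal power series, $\mathscr{P}^{(\le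 n)}:=\prod_{k=0}^n\mathscr{P}^{(k)}$, $\mathscr{F}^{(\geq n)}:=\prod_{k\geq n}\mathscr{P}^{(k)}$, all regarded as subspaces of $\mathscr{F}$; for $G\in\mathscr{F}$, $G^{(n)}$ is its component in $\mathscr{P}^{(n)}$. Thus $H^{(0)}$ is the quadratic part of $H$. A polynomial is action-preserving if it depends only on the actions $I_j=|u_j|^2=u_ju_{-j}$, i.e. only monomials $u^\alpha$ with $\alpha_j=\alpha_{-j}$ for all $j$ appear. The Poisson bracket is $$\{P,Q\}=\sum_{\alpha,\beta}\sum_j\big((-\mathrm{i})\,\omega(j)\alpha_j\beta_{-j}\big)P_\alpha Q_\beta\,u^{\alpha+\beta-\mathtt{e}_j-\mathtt{e}_{-j}},\qquad \omega(j)=j\,\frac{4+j^2}{1+j^2},$$ with $\mathtt{e}_k$ the $k$-th unit vector of $\mathbb{N}^{\mathbb{Z}}$, extended to $\mathscr{F}$ degree by degree. "Formally": for $\chi\in\mathscr{P}^{(m)}$, $m\geq1$, the Lie transformation $\Phi_\chi$ (formal time-one Hamiltonian flow of $\chi$) acts on $\mathscr{F}$ by $G\circ\Phi_\chi:=e^{\{\chi,\cdot\}}G=\sum_{k\geq0}\frac{1}{k!}\mathrm{ad}_\chi^k[G]$, $\mathrm{ad}_\chi[G]=\{\chi,G\}$, which is well defined on each degree. A formal symplectic transformation $\Phi_N$ is a finite composition of such Lie transformations, acting on $H$ as $e^{\{\chi_N,\cdot\}}\cdots e^{\{\chi_1,\cdot\}}H$ with $\chi_k\in\mathscr{P}^{(k)}$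 (no convergence is required). *)

theory Defs
  imports
    "HOL-Analysis.Analysis"
    "HOL-Library.Poly_Mapping"
    "HOL-Library.Function_Algebras"
begin

type_synonym mindex = "int \<Rightarrow>\<^sub>0 nat"

definition mdeg :: "mindex \<Rightarrow> nat" where
  "mdeg \<alpha> = (\<Sum>j\<in>Poly_Mapping.keys \<alpha>. Poly_Mapping.lookup \<alpha> j)"

definition momentum :: "mindex \<Rightarrow> int" where
  "momentum \<alpha> = (\<Sum>j\<in>Poly_Mapping.keys \<alpha>. j * int (Poly_Mapping.lookup \<alpha> j))"

abbreviation unit_idx :: "int \<Rightarrow> mindex" where
  "unit_idx j \<equiv> Poly_Mapping.single j 1"

definition indices :: "nat \<Rightarrow> mindex set" where
  "indices n = {\<alpha>. Poly_Mapping.lookup \<alpha> 0 = 0 \<and> mdeg \<alpha> = n + 2 \<and> momentum \<alpha> = 0}"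

text \<open>
  A formal power series is encoded as one coefficient function on all multi-indices, vanishing
  outside the union of the index sets; since these are pairwise disjoint, this is the product of
  the spaces of homogeneous polynomials, and those are subspaces of it.
\<close>

type_synonym fseries = "mindex \<Rightarrow> complex"

definition formal_series :: "fseries set" where
  "formal_series = {G. \<forall>\<alpha>. G \<alpha> \<noteq> 0 \<longrightarrow> (\<exists>n. \<alpha> \<in> indices n)}"

definition homog :: "nat \<Rightarrow> fseries set" where
  "homog n = {G. \<forall>\<alpha>. G \<alpha> \<noteq> 0 \<longrightarrow> \<alpha> \<in> indices n}"

definition homog_le :: "nat \<Rightarrow> fseries set" where
  "homog_le n = {G. \<forall>\<alpha>. G \<alpha> \<noteq> 0 \<longrightarrow> (\<exists>k\<le>n. \<alpha> \<in> indices k)}"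

definition homog_ge :: "nat \<Rightarrow> fseries set" where
  "homog_ge n = {G. \<forall>\<alpha>. G \<alpha> \<noteq> 0 \<longrightarrow> (\<exists>k\<ge>n. \<alpha> \<in> indices k)}"

definition component :: "nat \<Rightarrow> fseries \<Rightarrow> fseries" where
  "component n G = (\<lambda>\<alpha>. if \<alpha> \<in> indices n then G \<alpha> else 0)"

definition action_preserving :: "fseries \<Rightarrow> bool" where
  "action_preserving G \<longleftrightarrow>
     (\<forall>\<alpha>. G \<alpha> \<noteq> 0 \<longrightarrow> (\<forall>j. Poly_Mapping.lookup \<alpha> j = Poly_Mapping.lookup \<alpha> (- j)))"

definition omega :: "int \<Rightarrow> real" where
  "omega j = real_of_int j * (4 + (real_of_int j)^2) / (1 + (real_of_int j)^2)"

text \<open>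
  The triples \<open>(\<alpha>, \<beta>, j)\<close> contributing to the coefficient of \<open>u\<^sup>\<gamma>\<close> in a Poisson bracket. Terms with
  \<open>\<alpha>\<^sub>j \<beta>\<^sub>-\<^sub>j = 0\<close> vanish and are left out; this makes the set finite
  (lemma \<open>finite_bracket_terms\<close> below).
\<close>

definition bracket_terms :: "mindex \<Rightarrow> (mindex \<times> mindex \<times> int) set" where
  "bracket_terms \<gamma> = {(\<alpha>, \<beta>, j).
     (\<exists>m. \<alpha> \<in> indices m) \<and> (\<exists>n. \<beta> \<in> indices n) \<and>
     Poly_Mapping.lookup \<alpha> j \<noteq> 0 \<and> Poly_Mapping.lookup \<beta> (- j) \<noteq> 0 \<and>
     \<alpha> + \<beta> - unit_idx j - unit_idx (- j) = \<gamma>}"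

definition poisson :: "fseries \<Rightarrow> fseries \<Rightarrow> fseries" where
  "poisson P Q = (\<lambda>\<gamma>. \<Sum>(\<alpha>, \<beta>, j)\<in>bracket_terms \<gamma>.
     (- \<i>) * of_real (omega j) * of_nat (Poly_Mapping.lookup \<alpha> j)
       * of_nat (Poly_Mapping.lookup \<beta> (- j)) * P \<alpha> * Q \<beta>)"

text \<open>
  For \<open>S \<in> homog m\<close> with \<open>m \<ge> 1\<close> only finitely many terms of the exponential series contribute to
  each coefficient (lemma \<open>ad_power_eq_0\<close> below).
\<close>

definition lie_transform :: "fseries \<Rightarrow> fseries \<Rightarrow> fseries" where
  "lie_transform S G = (\<lambda>\<alpha>. suminf (\<lambda>k. 1 / fact k * ((poisson S ^^ k) G) \<alpha>))"

primrec lie_composition :: "(nat \<Rightarrow> fseries) \<Rightarrow> nat \<Rightarrow> fseries \<Rightarrow> fseries" where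
  "lie_composition S 0 G = G"
| "lie_composition S (Suc n) G = lie_transform (S (Suc n)) (lie_composition S n G)"

text \<open>A formal symplectic transformation is represented by its action \<open>G \<mapsto> G \<circ> \<Phi>\<close> on series.\<close>

definition formal_symplectic :: "nat \<Rightarrow> (fseries \<Rightarrow> fseries) set" where
  "formal_symplectic N = {lie_composition S N |S. \<forall>k\<in>{1..N}. S k \<in> homog k}"

text \<open>
  The expansion in the Fourier coefficients of \<open>\<integral> u\<^sup>p dx\<close> for \<open>u(x) = \<Sum>\<^sub>j\<^sub>\<noteq>\<^sub>0 u\<^sub>j e\<^sup>i\<^sup>j\<^sup>x\<close>: by multilinearity
  the coefficient of \<open>u\<^sup>\<alpha>\<close> collects all \<open>p\<close>-tuples \<open>(j\<^sub>1, \<dots>, j\<^sub>p)\<close> with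
  \<open>u\<^bsub>j\<^sub>1\<^esub> \<cdots> u\<^bsub>j\<^sub>p\<^esub> = u\<^sup>\<alpha>\<close>. The torus is \<open>\<real>/2\<pi>\<int>\<close> with normalized measure, the convention under which
  the bracket \<open>{u\<^sub>i, u\<^sub>j}\<close> carries no power of \<open>2\<pi>\<close>.
\<close>

definition torus_integral_power :: "nat \<Rightarrow> fseries" where
  "torus_integral_power p = (\<lambda>\<alpha>.
     \<Sum>js | length js = p \<and> 0 \<notin> set js \<and> (\<Sum>j\<leftarrow>js. unit_idx j) = \<alpha>.
       1 / (2 * of_real pi) * integral {0..2*pi} (\<lambda>x. \<Prod>j\<leftarrow>js. exp (\<i> * of_int j * of_real x)))"

definition dp_hamiltonian :: "real \<Rightarrow> fseries" where
  "dp_hamiltonian c =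
     (\<lambda>\<alpha>. of_real c / 2 * torus_integral_power 2 \<alpha> - 1 / 6 * torus_integral_power 3 \<alpha>)"

lemma mdeg_superset:
  assumes "finite A" "Poly_Mapping.keys \<alpha> \<subseteq> A"
  shows "mdeg \<alpha> = (\<Sum>j\<in>A. Poly_Mapping.lookup \<alpha> j)"
  unfolding mdeg_def using assms
  by (intro sum.mono_neutral_left) (auto simp: in_keys_iff)

lemma momentum_superset:
  assumes "finite A" "Poly_Mapping.keys \<alpha> \<subseteq> A"
  shows "momentum \<alpha> = (\<Sum>j\<in>A. j * int (Poly_Mapping.lookup \<alpha> j))"
  unfolding momentum_def using assms
  by (intro sum.mono_neutral_left) (auto simp: in_keys_iff)

lemma mdeg_add: "mdeg (\<alpha> + \<beta>) = mdeg \<alpha> + mdeg \<beta>"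
proof -
  let ?A = "Poly_Mapping.keys \<alpha> \<union> Poly_Mapping.keys \<beta>"
  have "Poly_Mapping.keys (\<alpha> + \<beta>) \<subseteq> ?A" by (rule keys_add)
  then show ?thesis
    using mdeg_superset[of ?A "\<alpha> + \<beta>"] mdeg_superset[of ?A \<alpha>] mdeg_superset[of ?A \<beta>]
    by (simp add: lookup_add sum.distrib)
qed

lemma momentum_add: "momentum (\<alpha> + \<beta>) = momentum \<alpha> + momentum \<beta>"
proof -
  let ?A = "Poly_Mapping.keys \<alpha> \<union> Poly_Mapping.keys \<beta>"
  have "Poly_Mapping.keys (\<alpha> + \<beta>) \<subseteq> ?A" by (rule keys_add)
  then show ?thesis
    using momentum_superset[of ?A "\<alpha> + \<beta>"] momentum_superset[of ?A \<alpha>] momentum_superset[of ?A \<beta>]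
    by (simp add: lookup_add sum.distrib algebra_simps)
qed

lemma mdeg_unit_idx [simp]: "mdeg (Poly_Mapping.single j (Suc 0)) = 1"
  by (simp add: mdeg_def)

lemma momentum_unit_idx [simp]: "momentum (Poly_Mapping.single j (Suc 0)) = j"
  by (simp add: momentum_def)

lemma idx_decompose:
  assumes "Poly_Mapping.lookup \<alpha> j \<noteq> 0"
  obtains \<alpha>' where "\<alpha> = \<alpha>' + unit_idx j"
proof
  show "\<alpha> = (\<alpha> - unit_idx j) + unit_idx j"
    using assms
    by (intro poly_mapping_eqI) (auto simp: lookup_add lookup_minus lookup_single when_def)
qed

lemma bracket_terms_decompose:
  assumes "(\<alpha>, \<beta>, j) \<in> bracket_terms \<gamma>"
  obtains \<alpha>' \<beta>' where
    "\<alpha> = \<alpha>' + unit_idx j" "\<beta> = \<beta>' + unit_idx (- j)" "\<alpha>' + \<beta>' = \<gamma>" "j = - momentum \<alpha>'"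
proof -
  have a: "Poly_Mapping.lookup \<alpha> j \<noteq> 0" and b: "Poly_Mapping.lookup \<beta> (- j) \<noteq> 0"
    and g: "\<alpha> + \<beta> - unit_idx j - unit_idx (- j) = \<gamma>" and m: "momentum \<alpha> = 0"
    using assms by (auto simp: bracket_terms_def indices_def)
  obtain \<alpha>' where \<alpha>': "\<alpha> = \<alpha>' + unit_idx j" using a by (rule idx_decompose)
  obtain \<beta>' where \<beta>': "\<beta> = \<beta>' + unit_idx (- j)" using b by (rule idx_decompose)
  have "\<alpha>' + \<beta>' = \<gamma>"
    unfolding g[symmetric] \<alpha>' \<beta>'
    by (intro poly_mapping_eqI) (auto simp: lookup_add lookup_minus)
  moreover have "j = - momentum \<alpha>'" using m \<alpha>' by (simp add: momentum_add)
  ultimately show thesis using that \<alpha>' \<beta>' by blast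
qed

lemma finite_dominated_idx:
  "finite {\<alpha> :: mindex. \<forall>j. Poly_Mapping.lookup \<alpha> j \<le> Poly_Mapping.lookup \<gamma> j}"
    (is "finite ?D")
proof -
  let ?K = "Poly_Mapping.keys \<gamma>"
  let ?F = "{f. \<forall>j. (j \<in> ?K \<longrightarrow> f j \<in> {..mdeg \<gamma>}) \<and> (j \<notin> ?K \<longrightarrow> f j = (0::nat))}"
  have "finite ?F"
    by (rule finite_set_of_finite_funs) auto
  moreover have "Poly_Mapping.lookup ` ?D \<subseteq> ?F"
  proof -
    have le: "Poly_Mapping.lookup \<gamma> j \<le> mdeg \<gamma>" if "j \<in> ?K" for j
      unfolding mdeg_def using that by (intro member_le_sum) auto
    show ?thesis
    proof clarify
      fix \<alpha> :: mindex and j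
      assume "\<forall>j. Poly_Mapping.lookup \<alpha> j \<le> Poly_Mapping.lookup \<gamma> j"
      then have "Poly_Mapping.lookup \<alpha> j \<le> Poly_Mapping.lookup \<gamma> j" by blast
      then show "(j \<in> ?K \<longrightarrow> Poly_Mapping.lookup \<alpha> j \<in> {..mdeg \<gamma>}) \<and>
                 (j \<notin> ?K \<longrightarrow> Poly_Mapping.lookup \<alpha> j = 0)"
        using le[of j] by (auto simp: in_keys_iff)
    qed
  qed
  ultimately have "finite (Poly_Mapping.lookup ` ?D)" by (rule rev_finite_subset)
  then show ?thesis
    by (rule finite_imageD) (auto simp: inj_on_def poly_mapping_eqI)
qed

lemma finite_bracket_terms: "finite (bracket_terms \<gamma>)"
proof -
  let ?D = "{\<alpha> :: mindex. \<forall>j. Poly_Mapping.lookup \<alpha> j \<le> Poly_Mapping.lookup \<gamma> j}"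
  let ?f = "\<lambda>(\<alpha>, \<beta>). (\<alpha> + unit_idx (- momentum \<alpha>), \<beta> + unit_idx (momentum \<alpha>), - momentum \<alpha>)"
  have "bracket_terms \<gamma> \<subseteq> ?f ` (?D \<times> ?D)"
  proof (clarify)
    fix \<alpha> \<beta> j assume "(\<alpha>, \<beta>, j) \<in> bracket_terms \<gamma>"
    then obtain \<alpha>' \<beta>' where *: "\<alpha> = \<alpha>' + unit_idx j" "\<beta> = \<beta>' + unit_idx (- j)"
      "\<alpha>' + \<beta>' = \<gamma>" "j = - momentum \<alpha>'"
      by (rule bracket_terms_decompose)
    then have "(\<alpha>, \<beta>, j) = ?f (\<alpha>', \<beta>')" by simp
    moreover have "(\<alpha>', \<beta>') \<in> ?D \<times> ?D" using *(3) by (auto simp: lookup_add)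
    ultimately show "(\<alpha>, \<beta>, j) \<in> ?f ` (?D \<times> ?D)" by (rule image_eqI)
  qed
  then show ?thesis
    by (rule finite_subset) (intro finite_imageI finite_cartesian_product finite_dominated_idx)
qed

lemma bracket_terms_indices:
  assumes "(\<alpha>, \<beta>, j) \<in> bracket_terms \<gamma>" "\<alpha> \<in> indices m" "\<beta> \<in> indices n"
  shows "\<gamma> \<in> indices (m + n)"
proof -
  obtain \<alpha>' \<beta>' where *: "\<alpha> = \<alpha>' + unit_idx j" "\<beta> = \<beta>' + unit_idx (- j)"
      "\<alpha>' + \<beta>' = \<gamma>" "j = - momentum \<alpha>'"
    using assms(1) by (rule bracket_terms_decompose)
  show ?thesis
    using assms(2,3) *(4) unfolding *(1,2) *(3)[symmetric]
    by (auto simp: indices_def mdeg_add momentum_add lookup_add)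
qed

lemma poisson_homog:
  assumes "P \<in> homog m" "Q \<in> homog n"
  shows "poisson P Q \<in> homog (m + n)"
proof -
  have "\<gamma> \<in> indices (m + n)" if nz: "poisson P Q \<gamma> \<noteq> 0" for \<gamma>
  proof -
    obtain t where t: "t \<in> bracket_terms \<gamma>"
      "(case t of (\<alpha>, \<beta>, j) \<Rightarrow> (- \<i>) * of_real (omega j) * of_nat (Poly_Mapping.lookup \<alpha> j)
         * of_nat (Poly_Mapping.lookup \<beta> (- j)) * P \<alpha> * Q \<beta>) \<noteq> 0"
      using nz unfolding poisson_def by (rule sum.not_neutral_contains_not_neutral)
    obtain \<alpha> \<beta> j where "t = (\<alpha>, \<beta>, j)" by (cases t)
    then show ?thesis
      using t assms bracket_terms_indices[of \<alpha> \<beta> j \<gamma> m n] by (auto simp: homog_def)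
  qed
  then show ?thesis by (auto simp: homog_def)
qed

lemma poisson_homog_ge:
  assumes "P \<in> homog m" "Q \<in> homog_ge n"
  shows "poisson P Q \<in> homog_ge (m + n)"
proof -
  have "\<exists>k\<ge>m + n. \<gamma> \<in> indices k" if nz: "poisson P Q \<gamma> \<noteq> 0" for \<gamma>
  proof -
    obtain t where t: "t \<in> bracket_terms \<gamma>"
      "(case t of (\<alpha>, \<beta>, j) \<Rightarrow> (- \<i>) * of_real (omega j) * of_nat (Poly_Mapping.lookup \<alpha> j)
         * of_nat (Poly_Mapping.lookup \<beta> (- j)) * P \<alpha> * Q \<beta>) \<noteq> 0"
      using nz unfolding poisson_def by (rule sum.not_neutral_contains_not_neutral)
    obtain \<alpha> \<beta> j where teq: "t = (\<alpha>, \<beta>, j)" by (cases t)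
    with t assms obtain k where "\<alpha> \<in> indices m" "\<beta> \<in> indices k" "k \<ge> n"
      by (auto simp: homog_def homog_ge_def)
    then have "\<gamma> \<in> indices (m + k)" "m + k \<ge> m + n"
      using t teq bracket_terms_indices[of \<alpha> \<beta> j \<gamma> m k] by auto
    then show ?thesis by blast
  qed
  then show ?thesis by (auto simp: homog_ge_def)
qed

lemma ad_power_homog_ge:
  assumes "S \<in> homog m" "G \<in> formal_series"
  shows "(poisson S ^^ k) G \<in> homog_ge (k * m)"
proof (induction k)
  case 0
  then show ?case using assms(2) by (simp add: formal_series_def homog_ge_def)
next
  case (Suc k)
  then show ?case using poisson_homog_ge[OF assms(1) Suc] by simp
qed

lemma ad_power_eq_0:
  assumes "S \<in> homog m" "G \<in> formal_series" "mdeg \<alpha> < k * m + 2"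
  shows "(poisson S ^^ k) G \<alpha> = 0"
  using ad_power_homog_ge[OF assms(1,2), of k] assms(3)
  by (fastforce simp: homog_ge_def indices_def)

text \<open>
  On trigonometric polynomials with zero average the series \<open>dp_hamiltonian c\<close> is the functional
  \<open>\<integral> c u\<^sup>2/2 - u\<^sup>3/6 dx\<close>.
\<close>

definition monomial_value :: "(int \<Rightarrow> complex) \<Rightarrow> mindex \<Rightarrow> complex" where
  "monomial_value a \<alpha> = (\<Prod>j\<in>Poly_Mapping.keys \<alpha>. a j ^ Poly_Mapping.lookup \<alpha> j)"

lemma keys_sum_list_unit_idx: "Poly_Mapping.keys (\<Sum>j\<leftarrow>js. unit_idx j) = set js"
  by (induction js) (auto simp: in_keys_iff lookup_add lookup_single when_def split: if_splits)

lemma mdeg_sum_list_unit_idx: "mdeg (\<Sum>j\<leftarrow>js. unit_idx j) = length js"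
  by (induction js) (auto simp: mdeg_add, simp add: mdeg_def)

lemma momentum_sum_list_unit_idx: "momentum (\<Sum>j\<leftarrow>js. unit_idx j) = sum_list js"
  by (induction js) (auto simp: momentum_add, simp add: momentum_def)

lemma monomial_value_superset:
  assumes "finite A" "Poly_Mapping.keys \<alpha> \<subseteq> A"
  shows "monomial_value a \<alpha> = (\<Prod>j\<in>A. a j ^ Poly_Mapping.lookup \<alpha> j)"
  unfolding monomial_value_def using assms
  by (intro prod.mono_neutral_left) (auto simp: in_keys_iff)

lemma monomial_value_add: "monomial_value a (\<alpha> + \<beta>) = monomial_value a \<alpha> * monomial_value a \<beta>"
proof -
  let ?A = "Poly_Mapping.keys \<alpha> \<union> Poly_Mapping.keys \<beta>"
  have "Poly_Mapping.keys (\<alpha> + \<beta>) \<subseteq> ?A" by (rule keys_add)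
  then show ?thesis
    using monomial_value_superset[of ?A "\<alpha> + \<beta>"] monomial_value_superset[of ?A \<alpha>]
      monomial_value_superset[of ?A \<beta>]
    by (simp add: lookup_add prod.distrib power_add)
qed

lemma monomial_value_sum_list: "monomial_value a (\<Sum>j\<leftarrow>js. unit_idx j) = (\<Prod>j\<leftarrow>js. a j)"
  by (induction js) (auto simp: monomial_value_add, auto simp: monomial_value_def)

lemma integral_exp_torus:
  "1 / (2 * of_real pi) * integral {0..2*pi} (\<lambda>x. \<Prod>j\<leftarrow>js. exp (\<i> * of_int j * of_real x)) =
     (if sum_list js = 0 then 1 else (0::complex))"
proof -
  have eq: "(\<Prod>j\<leftarrow>js. exp (\<i> * of_int j * of_real x)) = exp (\<i> * of_int (sum_list js) * of_real x)"
    for x :: real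
    by (induction js) (auto simp: algebra_simps exp_add)
  define m where "m = sum_list js"
  show ?thesis
  proof (cases "m = 0")
    case True
    then show ?thesis by (simp add: eq scaleR_conv_of_real flip: m_def)
  next
    case False
    let ?F = "\<lambda>x::real. exp (\<i> * of_int m * of_real x) / (\<i> * of_int m)"
    have "((\<lambda>x::real. exp (\<i> * of_int m * of_real x)) has_integral (?F (2*pi) - ?F 0)) {0..2*pi}"
    proof (rule fundamental_theorem_of_calculus)
      show "0 \<le> 2 * pi" by simp
      fix x :: real
      have "((\<lambda>z. exp (\<i> * of_int m * z) / (\<i> * of_int m)) has_field_derivative
              exp (\<i> * of_int m * of_real x)) (at (of_real x))"
        using False by (auto intro!: derivative_eq_intros)
      then show "(?F has_vector_derivative exp (\<i> * of_int m * of_real x)) (at x within {0..2*pi})"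
        by (rule has_vector_derivative_real_field)
    qed
    moreover have "exp (\<i> * of_int m * of_real (2*pi)) = (1::complex)"
      using exp_integer_2pi[of "of_int m"] by (simp add: algebra_simps)
    ultimately have "integral {0..2*pi} (\<lambda>x::real. exp (\<i> * of_int m * of_real x)) = 0"
      by (simp add: integral_unique)
    then show ?thesis using False by (simp add: eq flip: m_def)
  qed
qed

lemma torus_integral_power_homog: "torus_integral_power (n + 2) \<in> homog n"
proof -
  have "\<alpha> \<in> indices n" if nz: "torus_integral_power (n + 2) \<alpha> \<noteq> 0" for \<alpha>
  proof -
    obtain js where js: "length js = n + 2" "0 \<notin> set js" "(\<Sum>j\<leftarrow>js. unit_idx j) = \<alpha>"
      "(if sum_list js = 0 then 1 else (0::complex)) \<noteq> 0"
      using nz unfolding torus_integral_power_def integral_exp_torus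
      by (elim sum.not_neutral_contains_not_neutral) blast
    then have "sum_list js = 0" by (auto split: if_splits)
    moreover have "Poly_Mapping.keys \<alpha> = set js" "mdeg \<alpha> = length js" "momentum \<alpha> = sum_list js"
      unfolding js(3)[symmetric]
      by (rule keys_sum_list_unit_idx mdeg_sum_list_unit_idx momentum_sum_list_unit_idx)+
    ultimately show ?thesis
      using js(1,2) by (auto simp: indices_def in_keys_iff)
  qed
  then show ?thesis by (auto simp: homog_def)
qed

lemma dp_hamiltonian_formal_series: "dp_hamiltonian c \<in> formal_series"
proof -
  have "torus_integral_power 2 \<in> homog 0" "torus_integral_power 3 \<in> homog 1"
    using torus_integral_power_homog[of 0] torus_integral_power_homog[of 1]
    by (simp_all add: numeral_2_eq_2 numeral_3_eq_3)
  then have "\<And>\<alpha>. \<alpha> \<notin> indices 0 \<Longrightarrow> torus_integral_power 2 \<alpha> = 0"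
    and "\<And>\<alpha>. \<alpha> \<notin> indices 1 \<Longrightarrow> torus_integral_power 3 \<alpha> = 0"
    by (auto simp: homog_def)
  then show ?thesis
    unfolding formal_series_def dp_hamiltonian_def by fastforce
qed

lemma power_sum_lists:
  fixes f :: "'a \<Rightarrow> 'b::comm_semiring_1"
  assumes "finite S"
  shows "(\<Sum>j\<in>S. f j) ^ p = (\<Sum>js | set js \<subseteq> S \<and> length js = p. \<Prod>j\<leftarrow>js. f j)"
proof (induction p)
  case 0
  have "{js. set js \<subseteq> S \<and> length js = 0} = {[]}" by auto
  then show ?case by simp
next
  case (Suc p)
  let ?L = "{js. set js \<subseteq> S \<and> length js = p}"
  have img: "{js. set js \<subseteq> S \<and> length js = Suc p} = (\<lambda>(j, js). j # js) ` (S \<times> ?L)"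
    by (auto simp: length_Suc_conv image_iff)
  have inj: "inj_on (\<lambda>(j, js). j # js) (S \<times> ?L)" by (auto simp: inj_on_def)
  have "(\<Sum>js | set js \<subseteq> S \<and> length js = Suc p. \<Prod>j\<leftarrow>js. f j) =
        (\<Sum>(j, js)\<in>S \<times> ?L. f j * (\<Prod>j\<leftarrow>js. f j))"
    unfolding img by (subst sum.reindex[OF inj]) (auto intro: sum.cong)
  also have "\<dots> = (\<Sum>j\<in>S. f j) * (\<Sum>js\<in>?L. \<Prod>j\<leftarrow>js. f j)"
    by (simp add: sum_product sum.cartesian_product)
  finally show ?case using Suc by simp
qed

lemma prod_list_mult: "(\<Prod>j\<leftarrow>js. f j * g j :: 'a::comm_monoid_mult) = (\<Prod>j\<leftarrow>js. f j) * (\<Prod>j\<leftarrow>js. g j)"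
  by (induction js) (auto simp: mult_ac)

lemma torus_integral_power_value:
  fixes a :: "int \<Rightarrow> complex"
  assumes "finite S" "0 \<notin> S"
  defines "u \<equiv> \<lambda>x::real. \<Sum>j\<in>S. a j * exp (\<i> * of_int j * of_real x)"
  shows "1 / (2 * of_real pi) * integral {0..2*pi} (\<lambda>x. u x ^ p) =
     (\<Sum>\<alpha> | Poly_Mapping.keys \<alpha> \<subseteq> S \<and> mdeg \<alpha> = p. torus_integral_power p \<alpha> * monomial_value a \<alpha>)"
    and "finite {\<alpha>. Poly_Mapping.keys \<alpha> \<subseteq> S \<and> mdeg \<alpha> = p}"
proof -
  let ?L = "{js. set js \<subseteq> S \<and> length js = p}"
  let ?A = "{\<alpha>. Poly_Mapping.keys \<alpha> \<subseteq> S \<and> mdeg \<alpha> = p}"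
  let ?e = "\<lambda>js::int list. (\<Sum>j\<leftarrow>js. unit_idx j)"
  let ?g = "\<lambda>js (x::real). \<Prod>j\<leftarrow>js. exp (\<i> * of_int j * of_real x) :: complex"
  have finL: "finite ?L" using assms(1) by (rule finite_lists_length_eq)
  have "?A \<subseteq> {\<alpha>. \<forall>j. Poly_Mapping.lookup \<alpha> j \<le> Poly_Mapping.lookup (\<Sum>j\<in>S. Poly_Mapping.single j p) j}"
  proof (clarify)
    fix \<alpha> :: mindex and j assume *: "Poly_Mapping.keys \<alpha> \<subseteq> S" "p = mdeg \<alpha>"
    have "Poly_Mapping.lookup (\<Sum>j\<in>S. Poly_Mapping.single j (mdeg \<alpha>)) j = (if j \<in> S then mdeg \<alpha> else 0)"
      using assms(1) by (simp add: lookup_sum lookup_single when_def)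
    moreover have "Poly_Mapping.lookup \<alpha> j \<le> mdeg \<alpha>" if "j \<in> Poly_Mapping.keys \<alpha>"
      unfolding mdeg_def using that by (intro member_le_sum) auto
    ultimately show "Poly_Mapping.lookup \<alpha> j \<le>
        Poly_Mapping.lookup (\<Sum>j\<in>S. Poly_Mapping.single j (mdeg \<alpha>)) j"
      using * by (cases "j \<in> Poly_Mapping.keys \<alpha>") (auto simp: in_keys_iff)
  qed
  then show finA: "finite ?A" by (rule finite_subset) (rule finite_dominated_idx)
  have img: "?e ` ?L \<subseteq> ?A"
    by (auto simp: keys_sum_list_unit_idx mdeg_sum_list_unit_idx simp del: One_nat_def)
  have int: "?g js integrable_on {0..2*pi}" for js
  proof (rule integrable_continuous_real)
    show "continuous_on {0..2*pi} (?g js)"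
      by (induction js) (auto intro!: continuous_intros)
  qed
  have "u x ^ p = (\<Sum>js\<in>?L. (\<Prod>j\<leftarrow>js. a j) * ?g js x)" for x
    unfolding u_def power_sum_lists[OF assms(1)] prod_list_mult ..
  then have "1 / (2 * of_real pi) * integral {0..2*pi} (\<lambda>x. u x ^ p) =
      1 / (2 * of_real pi) * (\<Sum>js\<in>?L. integral {0..2*pi} (\<lambda>x. (\<Prod>j\<leftarrow>js. a j) * ?g js x))"
    using finL int by (simp add: integral_sum integrable_on_mult_right)
  also have "\<dots> = (\<Sum>js\<in>?L. (1 / (2 * of_real pi) * integral {0..2*pi} (?g js)) * monomial_value a (?e js))"
    unfolding sum_distrib_left monomial_value_sum_list by (simp add: mult_ac)
  also have "\<dots> = (\<Sum>\<alpha>\<in>?A. \<Sum>js | js \<in> ?L \<and> ?e js = \<alpha>.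
      (1 / (2 * of_real pi) * integral {0..2*pi} (?g js)) * monomial_value a (?e js))"
    by (rule sum.group[OF finL finA img, symmetric])
  also have "\<dots> = (\<Sum>\<alpha>\<in>?A. torus_integral_power p \<alpha> * monomial_value a \<alpha>)"
  proof (rule sum.cong[OF refl])
    fix \<alpha> assume "\<alpha> \<in> ?A"
    have "js \<in> ?L \<longleftrightarrow> length js = p \<and> 0 \<notin> set js" if "?e js = \<alpha>" for js
    proof -
      have "Poly_Mapping.keys \<alpha> = set js"
        unfolding that[symmetric] by (rule keys_sum_list_unit_idx)
      then show ?thesis using \<open>\<alpha> \<in> ?A\<close> assms(2) by blast
    qed
    then have "{js. js \<in> ?L \<and> ?e js = \<alpha>} = {js. length js = p \<and> 0 \<notin> set js \<and> ?e js = \<alpha>}"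
      by blast
    then show "(\<Sum>js | js \<in> ?L \<and> ?e js = \<alpha>.
        (1 / (2 * of_real pi) * integral {0..2*pi} (?g js)) * monomial_value a (?e js)) =
        torus_integral_power p \<alpha> * monomial_value a \<alpha>"
      unfolding torus_integral_power_def sum_distrib_right by (intro sum.cong) blast+
  qed
  finally show "1 / (2 * of_real pi) * integral {0..2*pi} (\<lambda>x. u x ^ p) =
    (\<Sum>\<alpha>\<in>?A. torus_integral_power p \<alpha> * monomial_value a \<alpha>)" .
qed

lemma dp_hamiltonian_value:
  fixes a :: "int \<Rightarrow> complex"
  assumes "finite S" "0 \<notin> S"
  defines "u \<equiv> \<lambda>x::real. \<Sum>j\<in>S. a j * exp (\<i> * of_int j * of_real x)"
  shows "1 / (2 * of_real pi) * integral {0..2*pi} (\<lambda>x. of_real c * u x ^ 2 / 2 - u x ^ 3 / 6) =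
     (\<Sum>\<alpha> | Poly_Mapping.keys \<alpha> \<subseteq> S \<and> mdeg \<alpha> \<in> {2, 3}. dp_hamiltonian c \<alpha> * monomial_value a \<alpha>)"
proof -
  let ?A = "\<lambda>p. {\<alpha>. Poly_Mapping.keys \<alpha> \<subseteq> S \<and> mdeg \<alpha> = p}"
  let ?T = "\<lambda>p \<alpha>. torus_integral_power p \<alpha> * monomial_value a \<alpha>"
  have int: "(\<lambda>x. u x ^ p) integrable_on {0..2*pi}" for p
    unfolding u_def by (intro integrable_continuous_real continuous_intros)
  have "integral {0..2*pi} (\<lambda>x. of_real c * u x ^ 2 / 2 - u x ^ 3 / 6) =
      integral {0..2*pi} (\<lambda>x. of_real c / 2 * u x ^ 2) - integral {0..2*pi} (\<lambda>x. 1 / 6 * u x ^ 3)"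
    using int by (subst integral_diff[symmetric]) (auto intro: integrable_on_mult_right)
  also have "\<dots> = of_real c / 2 * integral {0..2*pi} (\<lambda>x. u x ^ 2) - 1 / 6 * integral {0..2*pi} (\<lambda>x. u x ^ 3)"
    by simp
  finally have "1 / (2 * of_real pi) * integral {0..2*pi} (\<lambda>x. of_real c * u x ^ 2 / 2 - u x ^ 3 / 6) =
      of_real c / 2 * (1 / (2 * of_real pi) * integral {0..2*pi} (\<lambda>x. u x ^ 2))
      - 1 / 6 * (1 / (2 * of_real pi) * integral {0..2*pi} (\<lambda>x. u x ^ 3))"
    by (simp only: right_diff_distrib mult.left_commute)
  also have "\<dots> = of_real c / 2 * (\<Sum>\<alpha>\<in>?A 2. ?T 2 \<alpha>) - 1 / 6 * (\<Sum>\<alpha>\<in>?A 3. ?T 3 \<alpha>)"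
    unfolding u_def torus_integral_power_value(1)[OF assms(1,2)] ..
  also have "\<dots> = (\<Sum>\<alpha>\<in>?A 2. dp_hamiltonian c \<alpha> * monomial_value a \<alpha>)
      + (\<Sum>\<alpha>\<in>?A 3. dp_hamiltonian c \<alpha> * monomial_value a \<alpha>)"
  proof -
    have "torus_integral_power 3 \<alpha> = 0" if "mdeg \<alpha> = 2" for \<alpha>
      using that torus_integral_power_homog[of 1] by (auto simp: homog_def indices_def numeral_3_eq_3)
    moreover have "torus_integral_power 2 \<alpha> = 0" if "mdeg \<alpha> = 3" for \<alpha>
      using that torus_integral_power_homog[of 0] by (auto simp: homog_def indices_def numeral_2_eq_2)
    ultimately show ?thesis
      by (simp add: dp_hamiltonian_def sum_distrib_left sum_negf[symmetric] mult.assoc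
            del: sum_negf)
  qed
  also have "\<dots> = (\<Sum>\<alpha>\<in>?A 2 \<union> ?A 3. dp_hamiltonian c \<alpha> * monomial_value a \<alpha>)"
    using torus_integral_power_value(2)[OF assms(1,2)] by (intro sum.union_disjoint[symmetric]) auto
  also have "?A 2 \<union> ?A 3 = {\<alpha>. Poly_Mapping.keys \<alpha> \<subseteq> S \<and> mdeg \<alpha> \<in> {2, 3}}" by auto
  finally show ?thesis .
qed

end

theory Submission
  imports Defs "HOL-Computational_Algebra.Fundamental_Theorem_Algebra"
begin

text \<open>
  The frequencies \<open>c \<omega>(j)\<close> of the quadratic part of \<open>H\<close> are \<open>c\<close> times rational numbers, so they have
  many resonances besides the action-preserving ones, and a Birkhoff normal form built from \<open>H\<close> alone
  could retain monomials that are not action-preserving. None survives because of integrability: the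
  flow of \<open>H\<close> is the Degasperis-Procesi equation for \<open>v = u - c\<close>. It suffices to find one formal series \<open>K\<close>
  with \<open>{H, K} = 0\<close> whose quadratic part has no resonances except the action-preserving ones. Then \<open>K\<close>,
  and not \<open>H\<close>, is brought to normal form by Lie transforms (lemma \<open>birkhoff_normalisation\<close>); these
  preserve the relation \<open>{H, K} = 0\<close> (lemma \<open>poisson_lie_transform_eq_0\<close>, which rests on the Jacobi
  identity), and a series that commutes with a nonresonant normal form is itself action-preserving,
  degree by degree (lemma \<open>commuting_balanced\<close>).

  The series \<open>K\<close> comes from the Lax pair. With \<open>m = v - v\<^sub>x\<^sub>x\<close>, the logarithmic derivative \<open>p\<close> of a
  solution of the spectral problem \<open>\<psi>\<^sub>x\<^sub>x\<^sub>x - \<psi>\<^sub>x + \<mu> m \<psi> = 0\<close> satisfies the Riccati equation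
  \<open>p\<^sub>x\<^sub>x + 3 p p\<^sub>x + p\<^sup>3 - p + \<mu> m = 0\<close>. At \<open>u = 0\<close> one has \<open>m = - c \<noteq> 0\<close>, and the constant
  \<open>p = \<kappa>\<close> is a solution if \<open>\<mu> c = \<kappa>\<^sup>3 - \<kappa>\<close>; for real \<open>\<kappa> > 1\<close> the linearised equation is invertible at
  every Fourier mode, so \<open>p\<close> extends to a formal power series in \<open>u\<close> (lemma \<open>riccati_solution\<close>). Along the flow \<open>p\<close> obeys a
  conservation law (lemmas \<open>riccati_flux\<close> and \<open>dp_flow_riccati\<close>), so its average \<open>K\<close> is a constant of
  motion. Up to a constant factor the quadratic part of \<open>K\<close> has the coefficients
  \<open>(1 + j\<^sup>2)\<^sup>2 / (9\<kappa>\<^sup>4 + 3(j\<^sup>2 - 2)\<kappa>\<^sup>2 + (1 + j\<^sup>2)\<^sup>2)\<close>. As functions of \<open>\<kappa>\<^sup>2\<close> these have pairwise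
  disjoint sets of poles for different \<open>|j|\<close>, so each resonance relation that is not action-preserving
  excludes finitely many values of \<open>\<kappa>\<close>, and all but countably many \<open>\<kappa>\<close> are nonresonant (lemma
  \<open>nonresonant_kappa\<close>).
\<close>

section \<open>Multi-indices\<close>

abbreviation "lk \<equiv> Poly_Mapping.lookup"

lemma mdeg_zero [simp]: "mdeg 0 = 0" by (simp add: mdeg_def)
lemma momentum_zero [simp]: "momentum 0 = 0" by (simp add: momentum_def)

lemma mdeg_eq_0_iff [simp]: "mdeg \<alpha> = 0 \<longleftrightarrow> \<alpha> = 0"
proof
  assume "mdeg \<alpha> = 0"
  then have "lk \<alpha> j = 0" for j by (auto simp: mdeg_def in_keys_iff)
  then show "\<alpha> = 0" by (intro poly_mapping_eqI) simp
qed simp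

section \<open>Sums over the ways to split a multi-index\<close>

text \<open>
  Convolutions are written as sums over pairs instead of over the multi-indices below \<open>\<gamma>\<close>, so that
  reassociating and exchanging factors become bijections between such pairs.
\<close>

definition splits :: "mindex \<Rightarrow> (mindex \<times> mindex) set" where
  "splits \<gamma> = {(\<alpha>, \<beta>). \<alpha> + \<beta> = \<gamma>}"

lemma finite_splits [simp]: "finite (splits \<gamma>)"
proof -
  let ?D = "{\<alpha> :: mindex. \<forall>j. lk \<alpha> j \<le> lk \<gamma> j}"
  have "splits \<gamma> \<subseteq> ?D \<times> ?D" by (auto simp: splits_def lookup_add)
  then show ?thesis by (rule finite_subset) (intro finite_cartesian_product finite_dominated_idx)
qed

lemma splits_unit: "splits (unit_idx j) = {(0, unit_idx j), (unit_idx j, 0)}"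
proof -
  have "\<alpha> = 0 \<or> \<beta> = 0" if "\<alpha> + \<beta> = unit_idx j" for \<alpha> \<beta>
    using arg_cong[OF that, of mdeg] by (simp add: mdeg_add) (metis add_is_1 mdeg_eq_0_iff)
  then show ?thesis by (fastforce simp: splits_def)
qed

lemma sum_splits_swap: "(\<Sum>(\<alpha>, \<beta>)\<in>splits \<gamma>. f \<alpha> \<beta>) = (\<Sum>(\<alpha>, \<beta>)\<in>splits \<gamma>. f \<beta> \<alpha>)"
  by (rule sum.reindex_bij_witness[of _ prod.swap prod.swap]) (auto simp: splits_def add.commute)

lemma sum_splits_left_nested:
  "(\<Sum>(\<rho>, \<epsilon>)\<in>splits \<gamma>. \<Sum>(\<alpha>, \<beta>)\<in>splits \<rho>. f \<alpha> \<beta> \<epsilon>) =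
   (\<Sum>(\<alpha>, \<rho>)\<in>splits \<gamma>. \<Sum>(\<beta>, \<epsilon>)\<in>splits \<rho>. f \<alpha> \<beta> \<epsilon>)"
proof -
  have "(\<Sum>(\<rho>, \<epsilon>)\<in>splits \<gamma>. \<Sum>(\<alpha>, \<beta>)\<in>splits \<rho>. f \<alpha> \<beta> \<epsilon>) =
      (\<Sum>((\<rho>, \<epsilon>), (\<alpha>, \<beta>))\<in>(SIGMA x:splits \<gamma>. splits (fst x)). f \<alpha> \<beta> \<epsilon>)"
    by (subst sum.Sigma[symmetric]) (auto intro!: sum.cong)
  also have "\<dots> = (\<Sum>((\<alpha>, \<rho>), (\<beta>, \<epsilon>))\<in>(SIGMA x:splits \<gamma>. splits (snd x)). f \<alpha> \<beta> \<epsilon>)"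
    by (rule sum.reindex_bij_witness[of _
          "\<lambda>((\<alpha>, \<rho>), (\<beta>, \<epsilon>)). ((\<alpha> + \<beta>, \<epsilon>), (\<alpha>, \<beta>))" "\<lambda>((\<rho>, \<epsilon>), (\<alpha>, \<beta>)). ((\<alpha>, \<beta> + \<epsilon>), (\<beta>, \<epsilon>))"])
      (auto simp: splits_def add.assoc)
  also have "\<dots> = (\<Sum>(\<alpha>, \<rho>)\<in>splits \<gamma>. \<Sum>(\<beta>, \<epsilon>)\<in>splits \<rho>. f \<alpha> \<beta> \<epsilon>)"
    by (subst sum.Sigma[symmetric]) (auto intro!: sum.cong)
  finally show ?thesis .
qed

lemma sum_splits_exchange:
  "(\<Sum>(\<alpha>, \<rho>)\<in>splits \<gamma>. \<Sum>(\<beta>, \<epsilon>)\<in>splits \<rho>. f \<alpha> \<beta> \<epsilon>) =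
   (\<Sum>(\<beta>, \<rho>)\<in>splits \<gamma>. \<Sum>(\<alpha>, \<epsilon>)\<in>splits \<rho>. f \<alpha> \<beta> \<epsilon>)"
proof -
  have "(\<Sum>(\<alpha>, \<rho>)\<in>splits \<gamma>. \<Sum>(\<beta>, \<epsilon>)\<in>splits \<rho>. f \<alpha> \<beta> \<epsilon>) =
      (\<Sum>(\<rho>, \<epsilon>)\<in>splits \<gamma>. \<Sum>(\<alpha>, \<beta>)\<in>splits \<rho>. f \<alpha> \<beta> \<epsilon>)"
    by (rule sum_splits_left_nested[symmetric])
  also have "\<dots> = (\<Sum>(\<rho>, \<epsilon>)\<in>splits \<gamma>. \<Sum>(\<beta>, \<alpha>)\<in>splits \<rho>. f \<alpha> \<beta> \<epsilon>)"
    by (intro sum.cong refl) (auto intro: sum_splits_swap)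
  also have "\<dots> = (\<Sum>(\<beta>, \<rho>)\<in>splits \<gamma>. \<Sum>(\<alpha>, \<epsilon>)\<in>splits \<rho>. f \<alpha> \<beta> \<epsilon>)"
    by (rule sum_splits_left_nested)
  finally show ?thesis .
qed

lemma sum_splits_eval_right:
  fixes f :: "mindex \<Rightarrow> 'a::semiring_0"
  shows "(\<Sum>(\<alpha>, \<beta>)\<in>splits \<gamma>. f \<alpha> * (if \<beta> = 0 then z else 0)) = f \<gamma> * z"
proof -
  have "(\<Sum>(\<alpha>, \<beta>)\<in>splits \<gamma>. f \<alpha> * (if \<beta> = 0 then z else 0)) =
      (\<Sum>(\<alpha>, \<beta>)\<in>{(\<gamma>, 0 :: mindex)}. f \<alpha> * (if \<beta> = 0 then z else 0))"
    by (rule sum.mono_neutral_right) (simp, simp add: splits_def, auto simp: splits_def split: if_splits)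
  then show ?thesis by simp
qed

text \<open>
  Removing one unit \<open>j\<close> from \<open>\<alpha>\<close> is a bijection from the splittings of \<open>\<gamma> + e\<^sub>j\<close> with \<open>\<alpha>\<^sub>j > 0\<close> onto
  the splittings of \<open>\<gamma>\<close>; the factor \<open>\<alpha>\<^sub>j\<close> kills the other splittings.
\<close>

lemma sum_splits_shift:
  fixes h :: "mindex \<Rightarrow> mindex \<Rightarrow> complex"
  shows "(\<Sum>(\<alpha>, \<beta>)\<in>splits (\<gamma> + unit_idx j). of_nat (lk \<alpha> j) * h \<alpha> \<beta>) =
    (\<Sum>(\<alpha>, \<beta>)\<in>splits \<gamma>. of_nat (Suc (lk \<alpha> j)) * h (\<alpha> + unit_idx j) \<beta>)"
proof -
  let ?S = "{(\<alpha>, \<beta>)\<in>splits (\<gamma> + unit_idx j). lk \<alpha> j \<noteq> 0}"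
  have 1: "?S = (\<lambda>(\<alpha>, \<beta>). (\<alpha> + unit_idx j, \<beta>)) ` splits \<gamma>"
  proof safe
    fix \<alpha> \<beta> assume *: "(\<alpha>, \<beta>) \<in> splits (\<gamma> + unit_idx j)" "0 < lk \<alpha> j"
    then obtain \<alpha>' where "\<alpha> = \<alpha>' + unit_idx j" using idx_decompose[of \<alpha> j] by auto
    with * show "(\<alpha>, \<beta>) \<in> (\<lambda>(\<alpha>, \<beta>). (\<alpha> + unit_idx j, \<beta>)) ` splits \<gamma>"
      by (intro image_eqI[of _ _ "(\<alpha>', \<beta>)"])
         (auto simp: splits_def ac_simps dest: add_right_imp_eq simp flip: add.assoc)
  qed (auto simp: splits_def lookup_add ac_simps)
  have "(\<Sum>(\<alpha>, \<beta>)\<in>splits (\<gamma> + unit_idx j). of_nat (lk \<alpha> j) * h \<alpha> \<beta>) =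
      (\<Sum>(\<alpha>, \<beta>)\<in>?S. of_nat (lk \<alpha> j) * h \<alpha> \<beta>)"
    by (rule sum.mono_neutral_right) auto
  also have "\<dots> = (\<Sum>(\<alpha>, \<beta>)\<in>splits \<gamma>. of_nat (Suc (lk \<alpha> j)) * h (\<alpha> + unit_idx j) \<beta>)"
    unfolding 1 by (subst sum.reindex) (auto simp: inj_on_def lookup_add intro!: sum.cong)
  finally show ?thesis .
qed

text \<open>
  This is the product rule for \<open>\<partial>/\<partial>u\<^sub>j\<close> at the level of coefficients. The summand \<open>h\<close> need not be a
  product of a function of \<open>\<alpha>\<close> and one of \<open>\<beta>\<close>: in the bracket the derivative that is applied to the
  right factor depends on the momentum of the left one.
\<close>

lemma sum_splits_leibniz:
  fixes h :: "mindex \<Rightarrow> mindex \<Rightarrow> complex"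
  shows "of_nat (Suc (lk \<gamma> j)) * (\<Sum>(\<alpha>, \<beta>)\<in>splits (\<gamma> + unit_idx j). h \<alpha> \<beta>) =
    (\<Sum>(\<alpha>, \<beta>)\<in>splits \<gamma>. of_nat (Suc (lk \<alpha> j)) * h (\<alpha> + unit_idx j) \<beta>) +
    (\<Sum>(\<alpha>, \<beta>)\<in>splits \<gamma>. of_nat (Suc (lk \<beta> j)) * h \<alpha> (\<beta> + unit_idx j))"
proof -
  have "of_nat (Suc (lk \<gamma> j)) * (\<Sum>(\<alpha>, \<beta>)\<in>splits (\<gamma> + unit_idx j). h \<alpha> \<beta>) =
      (\<Sum>(\<alpha>, \<beta>)\<in>splits (\<gamma> + unit_idx j). of_nat (lk \<alpha> j) * h \<alpha> \<beta> + of_nat (lk \<beta> j) * h \<alpha> \<beta>)"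
    unfolding sum_distrib_left
  proof (intro sum.cong refl, clarify)
    fix \<alpha> \<beta> assume "(\<alpha>, \<beta>) \<in> splits (\<gamma> + unit_idx j)"
    then have "Suc (lk \<gamma> j) = lk \<alpha> j + lk \<beta> j"
      by (auto simp: splits_def lookup_add dest!: arg_cong[where f = "\<lambda>\<gamma>. lk \<gamma> j"])
    then show "of_nat (Suc (lk \<gamma> j)) * h \<alpha> \<beta> = of_nat (lk \<alpha> j) * h \<alpha> \<beta> + of_nat (lk \<beta> j) * h \<alpha> \<beta>"
      by (simp add: distrib_right)
  qed
  also have "\<dots> = (\<Sum>(\<alpha>, \<beta>)\<in>splits (\<gamma> + unit_idx j). of_nat (lk \<alpha> j) * h \<alpha> \<beta>) +
      (\<Sum>(\<alpha>, \<beta>)\<in>splits (\<gamma> + unit_idx j). of_nat (lk \<beta> j) * h \<alpha> \<beta>)"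
    by (simp add: sum.distrib case_prod_unfold)
  also have "(\<Sum>(\<alpha>, \<beta>)\<in>splits (\<gamma> + unit_idx j). of_nat (lk \<beta> j) * h \<alpha> \<beta>) =
      (\<Sum>(\<alpha>, \<beta>)\<in>splits \<gamma>. of_nat (Suc (lk \<beta> j)) * h \<alpha> (\<beta> + unit_idx j))"
    using sum_splits_shift[of j "\<lambda>\<alpha> \<beta>. h \<beta> \<alpha>" \<gamma>]
    by (subst (1 2) sum_splits_swap)
  finally show ?thesis unfolding sum_splits_shift .
qed

section \<open>The differential algebra of translation-equivariant series\<close>

text \<open>
  A coefficient function on all multi-indices stands for the formal function
  \<open>x \<mapsto> \<Sum>\<^sub>\<alpha> F\<^sub>\<alpha> u\<^sup>\<alpha> e\<^bsup>i M(\<alpha>) x\<^esup>\<close> of a point of the torus, where \<open>M\<close> is the momentum. These are the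
  formal functions of \<open>u\<close> and \<open>x\<close> that are equivariant under translations, so the dependence on \<open>x\<close>
  need not be recorded: the derivative in \<open>x\<close> multiplies by \<open>i M(\<alpha>)\<close>, the average over the torus is
  the part of momentum zero, and the pointwise product is the convolution. A new type is needed since
  multiplication of plain functions is already pointwise in the index.
\<close>

typedef eqseries = "UNIV :: (mindex \<Rightarrow> complex) set" morphisms coef of_coef by simp

lemma coef_of_coef [simp]: "coef (of_coef f) = f" by (simp add: of_coef_inverse)

lemma eqseriesI: "(\<And>\<alpha>. coef F \<alpha> = coef G \<alpha>) \<Longrightarrow> F = G"
  by (simp add: coef_inject[symmetric] fun_eq_iff)

instantiation eqseries :: comm_ring_1
begin

definition "0 = of_coef (\<lambda>_. 0)"
definition "1 = of_coef (\<lambda>\<alpha>. if \<alpha> = 0 then 1 else 0)"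
definition "F + G = of_coef (\<lambda>\<alpha>. coef F \<alpha> + coef G \<alpha>)"
definition "F - G = of_coef (\<lambda>\<alpha>. coef F \<alpha> - coef G \<alpha>)"
definition "- F = of_coef (\<lambda>\<alpha>. - coef F \<alpha>)"
definition "F * G = of_coef (\<lambda>\<gamma>. \<Sum>(\<alpha>, \<beta>)\<in>splits \<gamma>. coef F \<alpha> * coef G \<beta>)"

instance
proof
  fix F G H :: eqseries
  show "F * G * H = F * (G * H)"
    using sum_splits_left_nested[of "\<lambda>\<alpha> \<beta> \<epsilon>. coef F \<alpha> * (coef G \<beta> * coef H \<epsilon>)"]
    by (intro eqseriesI)
       (simp add: times_eqseries_def sum_distrib_left sum_distrib_right mult.assoc case_prod_unfold)
  show "F * G = G * F"
    unfolding times_eqseries_def by (subst sum_splits_swap) (simp add: mult.commute)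
  show "1 * F = F"
  proof (rule eqseriesI)
    fix \<alpha>
    show "coef (1 * F) \<alpha> = coef F \<alpha>"
      using sum_splits_eval_right[of "coef F" 1 \<alpha>]
      by (subst (asm) sum_splits_swap) (simp add: times_eqseries_def one_eqseries_def mult.commute)
  qed
  show "(0::eqseries) \<noteq> 1"
    by (auto simp: zero_eqseries_def one_eqseries_def dest!: arg_cong[where f = "\<lambda>F. coef F 0"])
qed (auto intro!: eqseriesI simp: zero_eqseries_def plus_eqseries_def uminus_eqseries_def
      minus_eqseries_def times_eqseries_def distrib_right sum.distrib case_prod_unfold)

end

lemma coef_ring [simp]: "coef 0 \<alpha> = 0" "coef (F + G) \<alpha> = coef F \<alpha> + coef G \<alpha>"
  "coef (F - G) \<alpha> = coef F \<alpha> - coef G \<alpha>" "coef (- F) \<alpha> = - coef F \<alpha>"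
  by (simp_all add: zero_eqseries_def plus_eqseries_def minus_eqseries_def uminus_eqseries_def)

lemma coef_mult: "coef (F * G) \<gamma> = (\<Sum>(\<alpha>, \<beta>)\<in>splits \<gamma>. coef F \<alpha> * coef G \<beta>)"
  by (simp add: times_eqseries_def)

definition const :: "complex \<Rightarrow> eqseries" where
  "const z = of_coef (\<lambda>\<alpha>. if \<alpha> = 0 then z else 0)"

lemma coef_const_mult [simp]: "coef (const z * F) \<alpha> = z * coef F \<alpha>"
  using sum_splits_eval_right[of "coef F" z \<alpha>]
  by (subst mult.commute) (simp add: coef_mult const_def mult.commute)

lemma const_arith: "const (x + y) = const x + const y" "const (x - y) = const x - const y" "const (x * y) = const x * const y"
  "const 0 = 0" "const 1 = 1" "const (- x) = - const x"
  by (auto intro!: eqseriesI) (auto simp: const_def one_eqseries_def)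

lemma numeral_eq_const: "numeral n = const (numeral n)"
proof -
  have "of_nat k = const (of_nat k)" for k by (induction k) (simp_all add: const_arith)
  from this[of "numeral n"] show ?thesis by simp
qed

lemma coef_numeral_mult [simp]: "coef (numeral n * F) \<alpha> = numeral n * coef F \<alpha>"
  by (simp add: numeral_eq_const)

definition dx :: "eqseries \<Rightarrow> eqseries" where
  "dx F = of_coef (\<lambda>\<alpha>. \<i> * of_int (momentum \<alpha>) * coef F \<alpha>)"

lemma coef_dx [simp]: "coef (dx F) \<alpha> = \<i> * of_int (momentum \<alpha>) * coef F \<alpha>"
  by (simp add: dx_def)

lemma dx_add: "dx (F + G) = dx F + dx G" by (rule eqseriesI) (simp add: algebra_simps)

lemma dx_mult: "dx (F * G) = dx F * G + F * dx G"
proof (rule eqseriesI)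
  fix \<gamma>
  have "\<i> * of_int (momentum \<gamma>) * (coef F \<alpha> * coef G \<beta>) =
      coef (dx F) \<alpha> * coef G \<beta> + coef F \<alpha> * coef (dx G) \<beta>" if "(\<alpha>, \<beta>) \<in> splits \<gamma>" for \<alpha> \<beta>
    using that by (auto simp: splits_def momentum_add algebra_simps)
  then show "coef (dx (F * G)) \<gamma> = coef (dx F * G + F * dx G) \<gamma>"
    unfolding coef_dx[of "F * G"] coef_ring coef_mult sum_distrib_left sum.distrib[symmetric]
    by (intro sum.cong refl) auto
qed

lemma dx_const: "dx (const z) = 0" by (rule eqseriesI) (simp add: const_def)

text \<open>
  The coefficients of \<open>\<partial>G/\<partial>u\<^sub>j\<close>.
\<close>

definition partial :: "int \<Rightarrow> (mindex \<Rightarrow> complex) \<Rightarrow> mindex \<Rightarrow> complex" where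
  "partial j G \<alpha> = of_nat (Suc (lk \<alpha> j)) * G (\<alpha> + unit_idx j)"

lemma partial_commute: "partial j (partial k G) = partial k (partial j G)"
  by (rule ext) (auto simp: partial_def lookup_add lookup_single when_def ac_simps)

text \<open>
  The derivative of \<open>G\<close> along a vector field \<open>u' = V(u)\<close> is \<open>\<Sum>\<^sub>j V\<^sub>j \<partial>G/\<partial>u\<^sub>j\<close>, where \<open>V\<^sub>j\<close>, the \<open>j\<close>-th
  Fourier coefficient of \<open>V\<close>, consists of the monomials of momentum \<open>j\<close>. Summing over the monomials
  of \<open>V\<close> therefore absorbs the infinite sum over \<open>j\<close>.
\<close>

definition lie_deriv :: "(mindex \<Rightarrow> complex) \<Rightarrow> (mindex \<Rightarrow> complex) \<Rightarrow> mindex \<Rightarrow> complex" where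
  "lie_deriv V G \<gamma> = (\<Sum>(\<alpha>, \<beta>)\<in>splits \<gamma>. V \<alpha> * partial (momentum \<alpha>) G \<beta>)"

definition flow :: "(mindex \<Rightarrow> complex) \<Rightarrow> eqseries \<Rightarrow> eqseries" where
  "flow V F = of_coef (lie_deriv V (coef F))"

lemma flow_add: "flow V (F + G) = flow V F + flow V G"
  by (rule eqseriesI)
     (simp add: flow_def lie_deriv_def partial_def algebra_simps sum.distrib case_prod_unfold)

lemma partial_mult: "partial j (coef (F * G)) \<gamma> =
  (\<Sum>(\<alpha>, \<beta>)\<in>splits \<gamma>. partial j (coef F) \<alpha> * coef G \<beta>) + (\<Sum>(\<alpha>, \<beta>)\<in>splits \<gamma>. coef F \<alpha> * partial j (coef G) \<beta>)"
  unfolding partial_def coef_mult sum_splits_leibniz by (simp add: mult_ac)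

lemma flow_mult: "flow V (F * G) = flow V F * G + F * flow V G"
proof (rule eqseriesI)
  fix \<gamma>
  have "coef (flow V (F * G)) \<gamma> =
      (\<Sum>(\<alpha>, \<rho>)\<in>splits \<gamma>. \<Sum>(\<beta>, \<epsilon>)\<in>splits \<rho>. V \<alpha> * partial (momentum \<alpha>) (coef F) \<beta> * coef G \<epsilon>) +
      (\<Sum>(\<alpha>, \<rho>)\<in>splits \<gamma>. \<Sum>(\<beta>, \<epsilon>)\<in>splits \<rho>. V \<alpha> * coef F \<beta> * partial (momentum \<alpha>) (coef G) \<epsilon>)"
    by (simp add: flow_def lie_deriv_def partial_mult distrib_left sum_distrib_left sum.distrib
        case_prod_unfold mult.assoc)
  also have "(\<Sum>(\<alpha>, \<rho>)\<in>splits \<gamma>. \<Sum>(\<beta>, \<epsilon>)\<in>splits \<rho>. V \<alpha> * partial (momentum \<alpha>) (coef F) \<beta> * coef G \<epsilon>) =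
      coef (flow V F * G) \<gamma>"
    unfolding sum_splits_left_nested[symmetric]
    by (simp add: flow_def lie_deriv_def coef_mult sum_distrib_right case_prod_unfold)
  also have "(\<Sum>(\<alpha>, \<rho>)\<in>splits \<gamma>. \<Sum>(\<beta>, \<epsilon>)\<in>splits \<rho>. V \<alpha> * coef F \<beta> * partial (momentum \<alpha>) (coef G) \<epsilon>) =
      coef (F * flow V G) \<gamma>"
    by (subst sum_splits_exchange)
       (simp add: flow_def lie_deriv_def coef_mult sum_distrib_left case_prod_unfold mult_ac)
  finally show "coef (flow V (F * G)) \<gamma> = coef (flow V F * G + F * flow V G) \<gamma>" by simp
qed

lemma flow_const: "flow V (const z) = 0"
proof (rule eqseriesI)
  have "\<beta> + unit_idx j \<noteq> 0" for \<beta> j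
    by (metis mdeg_add mdeg_unit_idx mdeg_zero add_is_0 zero_neq_one One_nat_def)
  then show "coef (flow V (const z)) \<gamma> = coef 0 \<gamma>" for \<gamma>
    by (simp add: flow_def lie_deriv_def partial_def const_def)
qed

text \<open>
  Replacing a factor \<open>u\<^sub>j\<close> by a monomial of momentum \<open>j\<close> does not change the momentum.
\<close>

lemma flow_dx: "flow V (dx F) = dx (flow V F)"
  by (rule eqseriesI)
     (auto simp: flow_def lie_deriv_def partial_def sum_distrib_left splits_def momentum_add
       algebra_simps intro!: sum.cong)

section \<open>The bracket as a Lie derivative\<close>

text \<open>
  The Hamiltonian vector field \<open>J \<nabla>P\<close>: the \<open>j\<close>-th Fourier coefficient of the gradient is
  \<open>\<partial>P/\<partial>u\<^sub>-\<^sub>j\<close>, and \<open>J = (1 - \<partial>\<^sub>x\<^sup>2)\<^sup>-\<^sup>1 (4 - \<partial>\<^sub>x\<^sup>2) \<partial>\<^sub>x\<close> has the symbol \<open>i \<omega>(j)\<close>.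
\<close>

definition ham_field :: "fseries \<Rightarrow> mindex \<Rightarrow> complex" where
  "ham_field P \<alpha> = \<i> * of_real (omega (momentum \<alpha>)) * partial (- momentum \<alpha>) P \<alpha>"

lemma omega_minus [simp]: "omega (- j) = - omega j" by (simp add: omega_def)
lemma omega_0 [simp]: "omega 0 = 0" by (simp add: omega_def)
lemma omega_eq_0_iff [simp]: "omega j = 0 \<longleftrightarrow> j = 0"
  by (simp add: omega_def add_nonneg_eq_0_iff)

text \<open>
  In a term of the bracket \<open>\<alpha> = \<alpha>' + e\<^sub>j\<close> has momentum zero, so \<open>j\<close> is determined by \<open>\<alpha>'\<close>, and the
  terms correspond to the splittings \<open>\<gamma> = \<alpha>' + \<beta>'\<close>.
\<close>

lemma poisson_eq_lie_deriv:
  assumes "P \<in> formal_series" "Q \<in> formal_series"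
  shows "poisson P Q \<gamma> = lie_deriv (ham_field P) Q \<gamma>"
proof -
  define g where "g = (\<lambda>(\<alpha>, \<beta>). (\<alpha> + unit_idx (- momentum \<alpha>), \<beta> + unit_idx (momentum \<alpha>), - momentum \<alpha>))"
  define t where "t = (\<lambda>(\<alpha>, \<beta>, j). (- \<i>) * of_real (omega j) * of_nat (lk \<alpha> j)
         * of_nat (lk \<beta> (- j)) * P \<alpha> * Q \<beta>)"
  have inj: "inj_on g (splits \<gamma>)" by (auto simp: g_def inj_on_def)
  have sub: "bracket_terms \<gamma> \<subseteq> g ` splits \<gamma>"
  proof clarify
    fix \<alpha> \<beta> j assume "(\<alpha>, \<beta>, j) \<in> bracket_terms \<gamma>"
    then obtain \<alpha>' \<beta>' where "\<alpha> = \<alpha>' + unit_idx j" "\<beta> = \<beta>' + unit_idx (- j)"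
      "\<alpha>' + \<beta>' = \<gamma>" "j = - momentum \<alpha>'"
      by (rule bracket_terms_decompose)
    then show "(\<alpha>, \<beta>, j) \<in> g ` splits \<gamma>"
      by (intro image_eqI[of _ _ "(\<alpha>', \<beta>')"]) (auto simp: g_def splits_def)
  qed
  have "t x = 0" if x: "x \<in> g ` splits \<gamma> - bracket_terms \<gamma>" for x
  proof (rule ccontr)
    assume nz: "t x \<noteq> 0"
    obtain \<alpha> \<beta> where s: "\<alpha> + \<beta> = \<gamma>"
      and xe: "x = (\<alpha> + unit_idx (- momentum \<alpha>), \<beta> + unit_idx (momentum \<alpha>), - momentum \<alpha>)"
      using x by (auto simp: g_def splits_def)
    have "\<alpha> + unit_idx (- momentum \<alpha>) + (\<beta> + unit_idx (momentum \<alpha>)) - unit_idx (- momentum \<alpha>)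
        - unit_idx (momentum \<alpha>) = \<gamma>"
      unfolding s[symmetric] by (intro poly_mapping_eqI) (auto simp: lookup_add lookup_minus)
    then have "x \<in> bracket_terms \<gamma>"
      using nz assms unfolding xe by (auto simp: bracket_terms_def formal_series_def t_def)
    with x show False by blast
  qed
  then have "poisson P Q \<gamma> = sum t (g ` splits \<gamma>)"
    unfolding poisson_def t_def[symmetric] using sub by (intro sum.mono_neutral_left) auto
  also have "\<dots> = (\<Sum>x\<in>splits \<gamma>. t (g x))" using inj by (simp add: sum.reindex)
  also have "\<dots> = lie_deriv (ham_field P) Q \<gamma>"
    unfolding lie_deriv_def
    by (intro sum.cong refl) (auto simp: t_def g_def ham_field_def partial_def lookup_add algebra_simps)
  finally show ?thesis .
qed

section \<open>The conservation law behind the Lax pair\<close>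

text \<open>
  The Degasperis-Procesi equation \<open>m\<^sub>t = - v m\<^sub>x - 3 v\<^sub>x m\<close>, \<open>m = v - v\<^sub>x\<^sub>x\<close>, is the compatibility condition
  of \<open>\<psi>\<^sub>x\<^sub>x\<^sub>x - \<psi>\<^sub>x + l m \<psi> = 0\<close> and \<open>l \<psi>\<^sub>t = - \<psi>\<^sub>x\<^sub>x - l v \<psi>\<^sub>x + (l v\<^sub>x + const) \<psi>\<close>. In terms of
  \<open>p = \<psi>\<^sub>x / \<psi>\<close> the first equation is the Riccati equation below, and the second one says that \<open>l p\<^sub>t\<close> is
  the \<open>x\<close>-derivative of \<open>f\<close>. This is consistent because the derivative of \<open>f\<close> satisfies the equation
  obtained by differentiating the Riccati equation (times \<open>l\<close>) in time, with \<open>m\<^sub>t\<close> eliminated.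
\<close>

lemma riccati_flux:
  fixes D :: "'a::comm_ring_1 \<Rightarrow> 'a"
  assumes add: "\<And>x y. D (x + y) = D x + D y" and mult: "\<And>x y. D (x * y) = D x * y + x * D y"
    and l: "D l = 0" and ric: "D (D p) + 3 * p * D p + p ^ 3 - p + l * m = 0"
    and m: "m = v - D (D v)"
  defines "f \<equiv> - (D p + p ^ 2) - l * v * p + l * D v"
  shows "D (D (D f)) + 3 * (D f * D p + p * D (D f)) + 3 * p ^ 2 * D f - D f
       = l ^ 2 * (v * D m + 3 * D v * m)"
proof -
  have D0: "D 0 = 0" using add[of 0 0] by simp
  have minus: "D (- x) = - D x" for x using add[of x "- x"] D0 by (simp add: eq_neg_iff_add_eq_0 add.commute)
  have diff: "D (x - y) = D x - D y" for x y using add[of x "- y"] minus by simp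
  have p2: "D (D p) = p - p * p * p - (p * D p + p * D p + p * D p) - l * m"
    using ric by (simp add: algebra_simps power3_eq_cube)
  have v2: "D (D v) = v - m" using m by simp
  have "D 1 = 0" using mult[of 1 1] by simp
  then have "D (of_nat n) = 0" for n by (induction n) (simp_all add: add D0)
  then have numeral: "D (numeral n) = 0" for n by (metis of_nat_numeral)
  show ?thesis
    unfolding f_def power2_eq_square
    by (simp add: add mult l numeral minus diff p2 v2) (simp add: algebra_simps)
qed

section \<open>The Degasperis-Procesi vector field\<close>

text \<open>
  The function \<open>u\<close> itself: the coordinate \<open>u\<^sub>j\<close> at frequency \<open>j \<noteq> 0\<close>.
\<close>

definition u_series :: eqseries where
  "u_series = of_coef (\<lambda>\<alpha>. if \<exists>j. j \<noteq> 0 \<and> \<alpha> = unit_idx j then 1 else 0)"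

lemma unit_idx_inj [simp]:
  fixes j k :: int
  shows "Poly_Mapping.single j (Suc 0) = Poly_Mapping.single k (Suc 0) \<longleftrightarrow> j = k"
  by (auto dest!: arg_cong[where f = momentum])

lemma unit_idx_neq_0 [simp]:
  fixes j :: int
  shows "Poly_Mapping.single j (Suc 0) \<noteq> 0"
  by (auto dest!: arg_cong[where f = mdeg])

lemma add_unit_idx_eq_unit_idx [simp]:
  fixes j k :: int
  shows "\<alpha> + Poly_Mapping.single j (Suc 0) = Poly_Mapping.single k (Suc 0) \<longleftrightarrow> \<alpha> = 0 \<and> j = k"
proof
  assume *: "\<alpha> + Poly_Mapping.single j (Suc 0) = Poly_Mapping.single k (Suc 0)"
  from arg_cong[OF *, of mdeg] have "\<alpha> = 0" by (simp add: mdeg_add)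
  with * show "\<alpha> = 0 \<and> j = k" by simp
qed simp

lemma partial_u_series: "j \<noteq> 0 \<Longrightarrow> partial j (coef u_series) \<alpha> = (if \<alpha> = 0 then 1 else 0)"
  by (auto simp: partial_def u_series_def)

lemma partial_u_series_mult:
  assumes "j \<noteq> 0"
  shows "partial j (coef (u_series * F)) \<gamma> = coef F \<gamma> + (\<Sum>(\<alpha>, \<beta>)\<in>splits \<gamma>. coef u_series \<alpha> * partial j (coef F) \<beta>)"
proof -
  have "(\<Sum>(\<alpha>, \<beta>)\<in>splits \<gamma>. partial j (coef u_series) \<alpha> * coef F \<beta>) = coef F \<gamma>"
    using sum_splits_eval_right[of "coef F" 1 \<gamma>]
    by (subst sum_splits_swap) (simp add: partial_u_series[OF assms] mult.commute)
  then show ?thesis by (simp add: partial_mult)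
qed

lemma partial_u_series_square: "j \<noteq> 0 \<Longrightarrow> partial j (coef (u_series * u_series)) \<gamma> = 2 * coef u_series \<gamma>"
  by (simp add: partial_u_series_mult partial_u_series sum_splits_eval_right)

lemma partial_u_series_cube: "j \<noteq> 0 \<Longrightarrow> partial j (coef (u_series * (u_series * u_series))) \<gamma> = 3 * coef (u_series * u_series) \<gamma>"
  by (simp add: partial_u_series_mult[of j "u_series * u_series"] partial_u_series_square)
     (simp add: coef_mult sum_distrib_left case_prod_unfold mult_ac)

definition lists_of :: "nat \<Rightarrow> mindex \<Rightarrow> int list set" where
  "lists_of p \<alpha> = {js. length js = p \<and> 0 \<notin> set js \<and> (\<Sum>j\<leftarrow>js. unit_idx j) = \<alpha>}"

lemma finite_lists_of [simp]: "finite (lists_of p \<alpha>)"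
proof (rule finite_subset)
  show "lists_of p \<alpha> \<subseteq> {js. set js \<subseteq> Poly_Mapping.keys \<alpha> \<and> length js = p}"
    unfolding lists_of_def by (auto simp: keys_sum_list_unit_idx simp del: One_nat_def)
  show "finite {js. set js \<subseteq> Poly_Mapping.keys \<alpha> \<and> length js = p}"
    by (rule finite_lists_length_eq) simp
qed

text \<open>
  Choosing the first entry of a list amounts to splitting off one unit multi-index.
\<close>

lemma coef_u_series_power: "coef (u_series ^ p) \<alpha> = of_nat (card (lists_of p \<alpha>))"
proof (induction p arbitrary: \<alpha>)
  case 0
  have "lists_of 0 \<alpha> = (if \<alpha> = 0 then {[]} else {})" by (auto simp: lists_of_def)
  then show ?case by (simp add: one_eqseries_def)
next
  case (Suc p \<gamma>)
  let ?U = "{(\<alpha>, \<beta>)\<in>splits \<gamma>. \<exists>j. j \<noteq> 0 \<and> \<alpha> = unit_idx j}"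
  have fin: "finite ?U" by (rule finite_subset[OF _ finite_splits]) auto
  have "coef (u_series ^ Suc p) \<gamma> = (\<Sum>(\<alpha>, \<beta>)\<in>splits \<gamma>. coef u_series \<alpha> * of_nat (card (lists_of p \<beta>)))"
    by (simp add: coef_mult Suc)
  also have "\<dots> = (\<Sum>(\<alpha>, \<beta>)\<in>?U. of_nat (card (lists_of p \<beta>)))"
    by (rule sum.mono_neutral_cong_right) (auto simp: u_series_def)
  also have "\<dots> = (\<Sum>x\<in>?U. \<Sum>js\<in>lists_of p (snd x). 1)" by (auto intro: sum.cong)
  also have "\<dots> = (\<Sum>x\<in>(SIGMA x:?U. lists_of p (snd x)). 1)"
    using fin by (subst sum.Sigma) auto
  also have "\<dots> = (\<Sum>js\<in>lists_of (Suc p) \<gamma>. 1)"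
    by (rule sum.reindex_bij_witness[of _
          "\<lambda>js. ((unit_idx (hd js), \<Sum>j\<leftarrow>tl js. unit_idx j), tl js)" "\<lambda>((\<alpha>, \<beta>), js). momentum \<alpha> # js"])
       (auto simp: lists_of_def splits_def length_Suc_conv)
  finally show ?case by simp
qed

lemma torus_integral_power_eq:
  "torus_integral_power p \<alpha> = (if momentum \<alpha> = 0 then coef (u_series ^ p) \<alpha> else 0)"
proof -
  have "torus_integral_power p \<alpha> = (\<Sum>js\<in>lists_of p \<alpha>. if sum_list js = 0 then 1 else 0)"
    unfolding torus_integral_power_def integral_exp_torus lists_of_def ..
  also have "\<dots> = (\<Sum>js\<in>lists_of p \<alpha>. if momentum \<alpha> = 0 then 1 else 0)"
    by (intro sum.cong refl) (auto simp: lists_of_def momentum_sum_list_unit_idx simp del: One_nat_def)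
  finally show ?thesis by (simp add: coef_u_series_power)
qed

text \<open>
  The gradient of \<open>\<integral> c u\<^sup>2/2 - u\<^sup>3/6 dx\<close> is \<open>c u - u\<^sup>2/2\<close>; its average is annihilated by \<open>\<omega>(0) = 0\<close>.
\<close>

lemma ham_field_dp_hamiltonian:
  "ham_field (dp_hamiltonian c) \<alpha> = \<i> * of_real (omega (momentum \<alpha>)) * 
     (of_real c * coef u_series \<alpha> - coef (u_series * u_series) \<alpha> / 2)"
proof (cases "momentum \<alpha> = 0")
  case False
  let ?j = "- momentum \<alpha>"
  have "momentum (\<alpha> + unit_idx ?j) = 0" by (simp add: momentum_add)
  then have "dp_hamiltonian c (\<alpha> + unit_idx ?j) =
      of_real c / 2 * coef (u_series * u_series) (\<alpha> + unit_idx ?j) - 1 / 6 * coef (u_series * (u_series * u_series)) (\<alpha> + unit_idx ?j)"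
    by (simp add: dp_hamiltonian_def torus_integral_power_eq power2_eq_square power3_eq_cube mult.assoc)
  then have "partial ?j (dp_hamiltonian c) \<alpha> =
      of_real c / 2 * partial ?j (coef (u_series * u_series)) \<alpha> - 1 / 6 * partial ?j (coef (u_series * (u_series * u_series))) \<alpha>"
    unfolding partial_def by (simp only: right_diff_distrib mult.left_commute)
  then show ?thesis using False by (simp add: ham_field_def partial_u_series_square partial_u_series_cube)
qed (simp add: ham_field_def)

abbreviation dp_flow :: "real \<Rightarrow> eqseries \<Rightarrow> eqseries" where
  "dp_flow c \<equiv> flow (ham_field (dp_hamiltonian c))"

lemma dp_flow_u_series: "coef (dp_flow c u_series) \<gamma> = ham_field (dp_hamiltonian c) \<gamma>"
proof -
  let ?V = "ham_field (dp_hamiltonian c)"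
  have "?V \<alpha> * partial (momentum \<alpha>) (coef u_series) \<beta> = ?V \<alpha> * (if \<beta> = 0 then 1 else 0)" for \<alpha> \<beta>
    by (cases "momentum \<alpha> = 0") (simp_all add: ham_field_def partial_u_series)
  then show ?thesis
    using sum_splits_eval_right[of ?V 1 \<gamma>] by (simp only: flow_def lie_deriv_def coef_of_coef mult_1_right)
qed

lemma flow_diff: "flow V (F - G) = flow V F - flow V G"
  using flow_add[of V "F - G" G] by simp

lemma dx_diff: "dx (F - G) = dx F - dx G"
  using dx_add[of "F - G" G] by simp

text \<open>
  The Hamiltonian flow is the dispersionless equation for the shifted function \<open>v = u - c\<close>, because
  \<open>c u - u\<^sup>2/2 = c\<^sup>2/2 - v\<^sup>2/2\<close> and \<open>(1 - \<partial>\<^sub>x\<^sup>2) J = (4 - \<partial>\<^sub>x\<^sup>2) \<partial>\<^sub>x\<close> is a differential operator.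
\<close>

lemma dp_flow_momentum_density:
  fixes c :: real
  defines "v \<equiv> u_series - const (of_real c)"
  defines "m \<equiv> v - dx (dx v)"
  shows "dp_flow c m = - (v * dx m + 3 * dx v * m)"
proof -
  let ?g = "const (1 / 2) * (v * v)"
  have "dp_flow c m = dp_flow c u_series - dx (dx (dp_flow c u_series))"
    by (simp add: m_def v_def flow_diff flow_const flow_dx dx_diff dx_const)
  also have "\<dots> = dx (dx (dx ?g)) - 4 * dx ?g"
  proof (rule eqseriesI)
    fix \<gamma>
    define k where "k = momentum \<gamma>"
    define h where "h = of_real c * coef u_series \<gamma> - coef (u_series * u_series) \<gamma> / 2"
    have "v * v = u_series * u_series - 2 * (const c * u_series) + const (c ^ 2)"
      by (simp add: v_def algebra_simps const_arith power2_eq_square)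
    then have "coef (v * v) \<gamma> = - 2 * h + coef (const (c ^ 2)) \<gamma>"
      by (simp add: h_def)
    moreover have "of_int k * coef (const (c ^ 2)) \<gamma> = 0" by (simp add: const_def k_def)
    ultimately have g: "coef (dx ?g) \<gamma> = - (\<i> * of_int k * h)"
      unfolding coef_dx coef_const_mult k_def[symmetric] by auto
    have om: "(1 + (of_int k)\<^sup>2) * of_real (omega k) = (of_int k * (4 + (of_int k)\<^sup>2) :: complex)"
    proof -
      have "(1 + (real_of_int k)\<^sup>2) * omega k = of_int k * (4 + (of_int k)\<^sup>2)"
        unfolding omega_def by (simp add: add_nonneg_eq_0_iff)
      from arg_cong[OF this, of complex_of_real] show ?thesis by simp
    qed
    have "coef (dp_flow c u_series - dx (dx (dp_flow c u_series))) \<gamma> =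
        (1 + (of_int k)\<^sup>2) * (\<i> * of_real (omega k) * h)"
      by (simp add: dp_flow_u_series ham_field_dp_hamiltonian k_def h_def power2_eq_square algebra_simps)
    also have "\<dots> = \<i> * (of_int k * (4 + (of_int k)\<^sup>2)) * h"
      unfolding om[symmetric] by (simp add: mult_ac)
    also have "\<dots> = coef (dx (dx (dx ?g)) - 4 * dx ?g) \<gamma>"
      unfolding coef_ring coef_numeral_mult coef_dx[of "dx (dx ?g)"] coef_dx[of "dx ?g"] g k_def[symmetric]
      by (simp add: algebra_simps power2_eq_square)
    finally show "coef (dp_flow c u_series - dx (dx (dp_flow c u_series))) \<gamma> = coef (dx (dx (dx ?g)) - 4 * dx ?g) \<gamma>" .
  qed
  also have "dx ?g = v * dx v"
    by (rule eqseriesI) (simp only: dx_mult dx_const coef_const_mult coef_ring, simp add: mult.commute[of "dx v" v])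
  also have "dx (dx (v * dx v)) - 4 * (v * dx v) = - (v * dx m + 3 * dx v * m)"
  proof -
    have three: "3 * x = x + x + x" and four: "4 * x = x + x + x + x" for x :: eqseries
      by simp_all
    show ?thesis
      unfolding m_def dx_diff three four by (simp add: dx_mult dx_add algebra_simps)
  qed
  finally show ?thesis .
qed

section \<open>Formal solution of the Riccati equation\<close>

text \<open>
  The \<open>u\<close>-adic filtration: \<open>F\<close> has order at least \<open>n\<close> in \<open>u\<close>.
\<close>

definition order_ge :: "nat \<Rightarrow> eqseries \<Rightarrow> bool" where
  "order_ge n F \<longleftrightarrow> (\<forall>\<alpha>. mdeg \<alpha> < n \<longrightarrow> coef F \<alpha> = 0)"

lemma order_ge_mult: "order_ge m F \<Longrightarrow> order_ge n G \<Longrightarrow> order_ge (m + n) (F * G)"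
  unfolding order_ge_def coef_mult
proof (intro allI impI sum.neutral ballI, clarify)
  fix \<gamma> \<alpha> \<beta>
  assume *: "\<forall>\<alpha>. mdeg \<alpha> < m \<longrightarrow> coef F \<alpha> = 0" "\<forall>\<alpha>. mdeg \<alpha> < n \<longrightarrow> coef G \<alpha> = 0"
    "mdeg \<gamma> < m + n" "(\<alpha>, \<beta>) \<in> splits \<gamma>"
  then have "mdeg \<alpha> < m \<or> mdeg \<beta> < n" by (auto simp: splits_def mdeg_add)
  then show "coef F \<alpha> * coef G \<beta> = 0" using * by auto
qed

lemma order_ge_add: "order_ge n F \<Longrightarrow> order_ge n G \<Longrightarrow> order_ge n (F + G)"
  and order_ge_diff: "order_ge n F \<Longrightarrow> order_ge n G \<Longrightarrow> order_ge n (F - G)"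
  and order_ge_dx: "order_ge n F \<Longrightarrow> order_ge n (dx F)"
  and order_ge_const: "order_ge n F \<Longrightarrow> order_ge n (const z * F)"
  and order_ge_mono: "order_ge n F \<Longrightarrow> k \<le> n \<Longrightarrow> order_ge k F"
  and order_ge_0: "order_ge 0 F"
  by (auto simp: order_ge_def)

text \<open>
  Banach's fixed point argument in the \<open>u\<close>-adic topology: the coefficients of degree below \<open>n\<close> are
  final after \<open>n\<close> iterations.
\<close>

lemma contraction_fixed_point:
  assumes "order_ge 1 (T 0)"
    and "\<And>F G n. order_ge 1 F \<Longrightarrow> order_ge 1 G \<Longrightarrow> order_ge n (F - G) \<Longrightarrow> order_ge (Suc n) (T F - T G)"
  obtains q where "T q = q" "order_ge 1 q"
proof -
  define s where "s = (\<lambda>n. (T ^^ n) 0)"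
  have s: "s 0 = 0" "s (Suc n) = T (s n)" for n by (simp_all add: s_def)
  have v1: "order_ge 1 (s n)" for n
  proof (induction n)
    case (Suc n)
    have "order_ge 1 (T (s n) - T 0)"
      using assms(2)[OF Suc, of 0 0] by (simp add: order_ge_def)
    from order_ge_add[OF this assms(1)] show ?case by (simp add: s)
  qed (simp add: s order_ge_def)
  have step: "order_ge n (s (Suc n) - s n)" for n
  proof (induction n)
    case (Suc n)
    show ?case using assms(2)[OF v1[of "Suc n"] v1[of n] Suc] by (simp only: s)
  qed (rule order_ge_0)
  have diff: "order_ge n (s (n + k) - s n)" for n k
  proof (induction k)
    case (Suc k)
    show ?case using order_ge_add[OF Suc order_ge_mono[OF step[of "n + k"]]] by simp
  qed (simp add: order_ge_def)
  define q where "q = of_coef (\<lambda>\<alpha>. coef (s (Suc (mdeg \<alpha>))) \<alpha>)"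
  have agree: "order_ge n (q - s n)" for n
  proof -
    have "coef q \<alpha> = coef (s n) \<alpha>" if "mdeg \<alpha> < n" for \<alpha>
      using diff[of "Suc (mdeg \<alpha>)" "n - Suc (mdeg \<alpha>)"] that by (simp add: q_def order_ge_def)
    then show ?thesis by (simp add: order_ge_def)
  qed
  have q1: "order_ge 1 q" using order_ge_add[OF agree[of 1] v1[of 1]] by simp
  have "order_ge n (T q - q)" for n
  proof -
    have "order_ge (Suc n) (T q - T (s n))" by (rule assms(2)[OF q1 v1 agree])
    then have "order_ge n (T q - s (Suc n))" by (simp add: s order_ge_def)
    from order_ge_diff[OF this order_ge_mono[OF agree[of "Suc n"], of n]] show ?thesis by simp
  qed
  then have "T q = q" by (intro eqseriesI) (auto simp: order_ge_def)
  with q1 show thesis by (rule that[rotated])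
qed

text \<open>
  The symbol of \<open>\<partial>\<^sub>x\<^sup>2 + 3\<kappa> \<partial>\<^sub>x + 3\<kappa>\<^sup>2 - 1\<close>, the linearisation of the Riccati equation at \<open>p = \<kappa>\<close>.
  For real \<open>\<kappa> > 1\<close> it has no zero, so no small divisors occur when \<open>p\<close> is expanded in \<open>u\<close>.
\<close>

definition riccati_symbol :: "real \<Rightarrow> int \<Rightarrow> complex" where
  "riccati_symbol \<kappa> k = 3 * of_real (\<kappa> ^ 2) - 1 - of_int k ^ 2 + 3 * \<i> * of_real \<kappa> * of_int k"

lemma riccati_symbol_neq_0:
  assumes "1 < \<kappa>" shows "riccati_symbol \<kappa> k \<noteq> 0"
proof
  assume z: "riccati_symbol \<kappa> k = 0"
  have "Im (riccati_symbol \<kappa> k) = 3 * \<kappa> * of_int k" by (simp add: riccati_symbol_def power2_eq_square)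
  with z assms have "k = 0" by simp
  then have "Re (riccati_symbol \<kappa> k) = 3 * \<kappa> ^ 2 - 1" by (simp add: riccati_symbol_def power2_eq_square)
  moreover have "\<kappa> ^ 2 > 1" using assms by (simp add: one_less_power)
  ultimately show False using z by simp
qed

definition riccati_inverse :: "real \<Rightarrow> eqseries \<Rightarrow> eqseries" where
  "riccati_inverse \<kappa> F = of_coef (\<lambda>\<alpha>. coef F \<alpha> / riccati_symbol \<kappa> (momentum \<alpha>))"

lemma order_ge_riccati_inverse: "order_ge n F \<Longrightarrow> order_ge n (riccati_inverse \<kappa> F)"
  by (simp add: order_ge_def riccati_inverse_def)

lemma riccati_inverse_diff: "riccati_inverse \<kappa> F - riccati_inverse \<kappa> G = riccati_inverse \<kappa> (F - G)"
  by (rule eqseriesI) (simp add: riccati_inverse_def diff_divide_distrib)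

definition w_series :: eqseries where "w_series = u_series - dx (dx u_series)"

lemma order_ge_w_series: "order_ge 1 w_series"
  unfolding w_series_def by (intro order_ge_diff order_ge_dx) (auto simp: order_ge_def u_series_def)

definition riccati_linear :: "real \<Rightarrow> eqseries \<Rightarrow> eqseries" where
  "riccati_linear \<kappa> F = dx (dx F) + const (3 * \<kappa>) * dx F + const (3 * \<kappa> ^ 2 - 1) * F"

lemma coef_riccati_linear: "coef (riccati_linear \<kappa> F) \<alpha> = riccati_symbol \<kappa> (momentum \<alpha>) * coef F \<alpha>"
  unfolding riccati_linear_def coef_ring coef_const_mult coef_dx
  by (simp add: riccati_symbol_def algebra_simps power2_eq_square)

text \<open>
  With \<open>p = \<kappa> + q\<close> the Riccati equation becomes a linear invertible operator applied to \<open>q\<close>, plus terms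
  of order two in \<open>q\<close> and a source of order one.
\<close>

lemma riccati_solution:
  assumes "1 < \<kappa>"
  obtains q where "order_ge 1 q"
    "riccati_linear \<kappa> q + 3 * q * dx q + const (3 * \<kappa>) * q ^ 2 + q ^ 3 + const z * w_series = 0"
proof -
  define N where "N = (\<lambda>F. 3 * (F * dx F) + const (3 * \<kappa>) * F ^ 2 + F ^ 3 + const z * w_series)"
  have T: "order_ge (Suc n) (riccati_inverse \<kappa> (- N F) - riccati_inverse \<kappa> (- N G))"
    if F: "order_ge 1 F" and G: "order_ge 1 G" and FG: "order_ge n (F - G)" for F G n
  proof -
    define E where "E = F - G"
    have E: "order_ge n E" using FG by (simp add: E_def)
    have "- N F - - N G = - (const 3 * (E * dx F) + const 3 * (G * dx E) + const (3 * \<kappa>) * (E * (F + G))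
        + E * (F * F + F * G + G * G))"
      by (simp add: N_def E_def dx_diff numeral_eq_const[of "num.Bit1 num.One", symmetric]
           algebra_simps power2_eq_square power3_eq_cube)
    moreover have "order_ge (Suc n) (const 3 * (E * dx F))"
      using order_ge_const[OF order_ge_mult[OF E order_ge_dx[OF F]]] by simp
    moreover have "order_ge (Suc n) (const 3 * (G * dx E))"
      using order_ge_const[OF order_ge_mult[OF G order_ge_dx[OF E]]] by simp
    moreover have "order_ge (Suc n) (const (3 * \<kappa>) * (E * (F + G)))"
      using order_ge_const[OF order_ge_mult[OF E order_ge_add[OF F G]]] by simp
    moreover have "order_ge (Suc n) (E * (F * F + F * G + G * G))"
    proof -
      have "order_ge 2 (F * F + F * G + G * G)"
        using order_ge_mult[OF F F] order_ge_mult[OF F G] order_ge_mult[OF G G]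
        by (auto intro!: order_ge_add simp: numeral_2_eq_2)
      from order_ge_mult[OF E this] show ?thesis by (rule order_ge_mono) simp
    qed
    ultimately have "order_ge (Suc n) (- N F - - N G)"
      by (simp add: order_ge_def)
    then show ?thesis unfolding riccati_inverse_diff by (rule order_ge_riccati_inverse)
  qed
  have "order_ge 1 (- N 0)" using order_ge_w_series by (simp add: N_def order_ge_def)
  then have "order_ge 1 (riccati_inverse \<kappa> (- N 0))" by (rule order_ge_riccati_inverse)
  from contraction_fixed_point[of "\<lambda>F. riccati_inverse \<kappa> (- N F)", OF this T]
  obtain q where q: "riccati_inverse \<kappa> (- N q) = q" "order_ge 1 q" .
  have "riccati_linear \<kappa> q + N q = 0"
  proof (rule eqseriesI)
    fix \<alpha>
    have "coef q \<alpha> = coef (- N q) \<alpha> / riccati_symbol \<kappa> (momentum \<alpha>)"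
      by (subst q(1)[symmetric]) (simp add: riccati_inverse_def)
    then show "coef (riccati_linear \<kappa> q + N q) \<alpha> = coef 0 \<alpha>"
      using riccati_symbol_neq_0[OF assms] by (simp add: coef_riccati_linear)
  qed
  then show thesis by (intro that[OF q(2)]) (simp add: N_def add.assoc mult.assoc)
qed

text \<open>
  The equation is an invertible operator applied to \<open>A\<close> plus terms in which \<open>A\<close> is multiplied by
  \<open>q\<close> or its derivative, hence have higher order than \<open>A\<close>.
\<close>

lemma linearised_riccati_injective:
  fixes \<kappa> :: real
  assumes "1 < \<kappa>" "order_ge 1 q"
  defines "p \<equiv> const \<kappa> + q"
  assumes L: "dx (dx A) + 3 * (A * dx p + p * dx A) + 3 * p ^ 2 * A - A = 0"
  shows "A = 0"
proof -
  have dp: "dx p = dx q" by (simp add: p_def dx_add dx_const)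
  define B where "B = const 3 * (A * dx q) + const 3 * (q * dx A) + const (6 * \<kappa>) * (A * q) + const 3 * (A * (q * q))"
  have e: "riccati_linear \<kappa> A + B = 0"
  proof -
    have cs: "const (3 * \<kappa>) = 3 * const \<kappa>" "const (3 * \<kappa> ^ 2 - 1) = 3 * (const \<kappa> * const \<kappa>) - 1" "const (6 * \<kappa>) = 6 * const \<kappa>"
      by (simp_all add: const_arith power2_eq_square numeral_eq_const)
    have "riccati_linear \<kappa> A + B = dx (dx A) + 3 * (A * dx p + p * dx A) + 3 * p ^ 2 * A - A"
      unfolding riccati_linear_def B_def dp cs unfolding p_def numeral_eq_const[symmetric]
      by (simp add: algebra_simps power2_eq_square)
    with L show ?thesis by simp
  qed
  have "order_ge n A" for n
  proof (induction n)
    case (Suc n)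
    have "order_ge (Suc n) B"
      unfolding B_def
    proof (intro order_ge_add order_ge_const)
      show "order_ge (Suc n) (A * dx q)" using order_ge_mult[OF Suc order_ge_dx[OF assms(2)]] by simp
      show "order_ge (Suc n) (q * dx A)" using order_ge_mult[OF assms(2) order_ge_dx[OF Suc]] by simp
      show "order_ge (Suc n) (A * q)" using order_ge_mult[OF Suc assms(2)] by simp
      show "order_ge (Suc n) (A * (q * q))" 
        using order_ge_mono[OF order_ge_mult[OF Suc order_ge_mult[OF assms(2,2)]], of "Suc n"] by simp
    qed
    then have "order_ge (Suc n) (riccati_linear \<kappa> A)" using e by (simp add: order_ge_def eq_neg_iff_add_eq_0[symmetric])
    then show ?case using riccati_symbol_neq_0[OF assms(1)] by (simp add: order_ge_def coef_riccati_linear)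
  qed (rule order_ge_0)
  then show "A = 0" by (intro eqseriesI) (auto simp: order_ge_def)
qed

text \<open>
  The time derivative of \<open>p\<close> and the expected flux, both multiplied by \<open>\<mu>\<close>, solve the same
  inhomogeneous linear equation, so that they agree by injectivity. The relation between \<open>\<mu>\<close> and
  \<open>\<kappa>\<close> says that the constant \<open>p = \<kappa>\<close> solves the Riccati equation at \<open>u = 0\<close>, where \<open>m = - c\<close>.
\<close>

lemma dp_flow_riccati:
  fixes c \<kappa> \<mu> :: real
  assumes "1 < \<kappa>" "\<mu> \<noteq> 0" "\<mu> * c = \<kappa> ^ 3 - \<kappa>" "order_ge 1 q"
    and q: "riccati_linear \<kappa> q + 3 * q * dx q + const (3 * \<kappa>) * q ^ 2 + q ^ 3 + const \<mu> * w_series = 0"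
  obtains F where "dp_flow c q = dx F"
proof -
  define v where "v = u_series - const c"
  define m where "m = v - dx (dx v)"
  define p where "p = const \<kappa> + q"
  define l where "l = const \<mu>"
  define f where "f = - (dx p + p ^ 2) - l * v * p + l * dx v"
  \<comment> \<open>\<open>A\<close> measures how far \<open>p\<close> is from satisfying the conservation law.\<close>
  define A where "A = l * dp_flow c p - dx f"
  have m: "m = w_series - const c" by (simp add: m_def v_def w_series_def dx_diff dx_const)
  have dp: "dx p = dx q" by (simp add: p_def dx_add dx_const)
  have ric: "dx (dx p) + 3 * p * dx p + p ^ 3 - p + l * m = 0"
  proof -
    have "const (\<mu> * c) = const \<kappa> ^ 3 - const \<kappa>"
      unfolding of_real_mult[symmetric] assms(3)
      by (simp add: const_arith power3_eq_cube)
    then have lm: "l * m = const \<mu> * w_series - (const \<kappa> ^ 3 - const \<kappa>)"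
      by (simp add: l_def m right_diff_distrib const_arith)
    have cs: "const (3 * \<kappa>) = 3 * const \<kappa>" "const (3 * \<kappa> ^ 2 - 1) = 3 * (const \<kappa> * const \<kappa>) - 1"
      by (simp_all add: const_arith power2_eq_square numeral_eq_const)
    have "dx (dx p) + 3 * p * dx p + p ^ 3 - p + l * m =
        riccati_linear \<kappa> q + 3 * q * dx q + const (3 * \<kappa>) * q ^ 2 + q ^ 3 + const \<mu> * w_series"
      unfolding riccati_linear_def lm dp cs unfolding p_def
      by (simp add: algebra_simps power2_eq_square power3_eq_cube)
    then show ?thesis using q by simp
  qed
  have flux: "dx (dx (dx f)) + 3 * (dx f * dx p + p * dx (dx f)) + 3 * p ^ 2 * dx f - dx f
       = l ^ 2 * (v * dx m + 3 * dx v * m)"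
    unfolding f_def
    by (rule riccati_flux[OF dx_add dx_mult _ ric m_def]) (simp add: l_def dx_const)
  let ?y = "dp_flow c p"
  have y: "dx (dx ?y) + 3 * (?y * dx p + p * dx ?y) + 3 * p ^ 2 * ?y - ?y = l * (v * dx m + 3 * dx v * m)"
  proof -
    have three: "dp_flow c (3 * F) = 3 * dp_flow c F" for F
      unfolding numeral_eq_const flow_mult flow_const by simp
    then have three': "dp_flow c (F * 3) = 3 * dp_flow c F" for F by (simp add: mult.commute)
    have l: "dp_flow c (l * F) = l * dp_flow c F" for F by (simp add: l_def flow_mult flow_const)
    have "dp_flow c 0 = 0" using flow_const[of _ 0] by (simp add: const_arith)
    then have "dp_flow c (dx (dx p) + 3 * p * dx p + p ^ 3 - p + l * m) = 0" by (simp add: ric)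
    then have "dx (dx ?y) + 3 * (?y * dx p + p * dx ?y) + 3 * p ^ 2 * ?y - ?y + l * dp_flow c m = 0"
      by (simp add: flow_add flow_diff flow_mult[of _ p] flow_dx three three' l mult.assoc
        power2_eq_square power3_eq_cube algebra_simps)
    moreover have "dp_flow c m = - (v * dx m + 3 * dx v * m)"
      unfolding m_def v_def by (rule dp_flow_momentum_density)
    ultimately show ?thesis by (simp add: algebra_simps)
  qed
  have dxl: "dx (l * G) = l * dx G" for G by (simp add: l_def dx_mult dx_const)
  have dA: "dx A = l * dx ?y - dx (dx f)" by (simp add: A_def dx_diff dxl)
  have "dx (dx A) + 3 * (A * dx p + p * dx A) + 3 * p ^ 2 * A - A =
      l * (dx (dx ?y) + 3 * (?y * dx p + p * dx ?y) + 3 * p ^ 2 * ?y - ?y)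
      - (dx (dx (dx f)) + 3 * (dx f * dx p + p * dx (dx f)) + 3 * p ^ 2 * dx f - dx f)"
    unfolding dA dx_diff dxl unfolding A_def by (simp add: algebra_simps)
  also have "\<dots> = 0" unfolding y flux by (simp add: power2_eq_square mult.assoc)
  finally have "A = 0"
    unfolding p_def by (rule linearised_riccati_injective[OF assms(1,4)])
  have "dp_flow c q = dx (const (1 / \<mu>) * f)"
  proof -
    have "dp_flow c q = ?y" by (simp add: p_def flow_add flow_const)
    also have "\<dots> = const (1 / \<mu>) * (l * ?y)"
      using assms(2) by (intro eqseriesI) (simp add: l_def)
    also have "l * ?y = dx f" using \<open>A = 0\<close> by (simp add: A_def)
    finally show ?thesis by (simp add: dx_mult dx_const)
  qed
  then show thesis by (rule that)
qed

section \<open>A formal constant of motion\<close>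

lemma poisson_formal_series:
  assumes "P \<in> formal_series" "Q \<in> formal_series"
  shows "poisson P Q \<in> formal_series"
  unfolding formal_series_def
proof (intro CollectI allI impI)
  fix \<gamma> assume "poisson P Q \<gamma> \<noteq> 0"
  then obtain \<alpha> \<beta> j where "(\<alpha>, \<beta>, j) \<in> bracket_terms \<gamma>"
    unfolding poisson_def by (metis (no_types, lifting) prod_cases3 sum.not_neutral_contains_not_neutral)
  moreover from this obtain m n where "\<alpha> \<in> indices m" "\<beta> \<in> indices n"
    by (auto simp: bracket_terms_def)
  ultimately show "\<exists>n. \<gamma> \<in> indices n" using bracket_terms_indices by blast
qed

text \<open>
  The average of \<open>p\<close> is conserved, since its time derivative is the average of an \<open>x\<close>-derivative.
  The quadratic part comes from the term \<open>3 \<kappa> q\<^sup>2\<close> alone, evaluated on the first-order solution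
  \<open>q\<^sub>j = - \<mu> (1 + j\<^sup>2) u\<^sub>j / riccati_symbol \<kappa> j\<close>: the term \<open>3 q q\<^sub>x\<close> is a derivative and averages to zero. The
  hypothesis \<open>c \<noteq> 0\<close> enters because \<open>\<mu>\<close> has to solve \<open>\<mu> c = \<kappa>\<^sup>3 - \<kappa>\<close>.
\<close>

lemma dp_conserved_series:
  assumes "c \<noteq> 0" "1 < \<kappa>"
  obtains K C where "K \<in> formal_series" "poisson (dp_hamiltonian c) K = 0" "C \<noteq> 0"
    "\<And>j. j \<noteq> 0 \<Longrightarrow> K (unit_idx j + unit_idx (- j)) =
      C * ((1 + of_int j ^ 2) ^ 2 / (riccati_symbol \<kappa> j * riccati_symbol \<kappa> (- j)))"
proof -
  define \<mu> where "\<mu> = (\<kappa> ^ 3 - \<kappa>) / c"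
  have "\<kappa> ^ 2 > 1" using assms by (simp add: one_less_power)
  then have "\<kappa> * (\<kappa> ^ 2 - 1) > 0" using assms by (intro mult_pos_pos) linarith+
  then have "\<kappa> * (\<kappa> ^ 2 - 1) \<noteq> 0" by linarith
  then have "\<kappa> ^ 3 - \<kappa> \<noteq> 0" by (simp add: power2_eq_square power3_eq_cube right_diff_distrib)
  then have \<mu>: "\<mu> \<noteq> 0" "\<mu> * c = \<kappa> ^ 3 - \<kappa>" using assms(1) by (simp_all add: \<mu>_def)
  obtain q where v: "order_ge 1 q"
    and q: "riccati_linear \<kappa> q + 3 * q * dx q + const (3 * \<kappa>) * q ^ 2 + q ^ 3 + const \<mu> * w_series = 0"
    using riccati_solution[OF assms(2)] .
  obtain F where F: "dp_flow c q = dx F"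
    using dp_flow_riccati[OF assms(2) \<mu> v q] .
  \<comment> \<open>The restriction to momentum zero takes the average over \<open>x\<close>; the restriction to degree at least
    two and to monomials without \<open>u\<^sub>0\<close> leaves the bracket with \<open>H\<close> unchanged.\<close>
  define K where "K = (\<lambda>\<alpha>. if \<exists>n. \<alpha> \<in> indices n then coef q \<alpha> else 0)"
  let ?V = "ham_field (dp_hamiltonian c)"
  have K: "K \<in> formal_series" by (auto simp: K_def formal_series_def)
  have "poisson (dp_hamiltonian c) K \<gamma> = 0" for \<gamma>
  proof (cases "\<exists>n. \<gamma> \<in> indices n")
    case False
    then show ?thesis
      using poisson_formal_series[OF dp_hamiltonian_formal_series K] by (auto simp: formal_series_def)
  next
    case True
    then have \<gamma>: "momentum \<gamma> = 0" "lk \<gamma> 0 = 0" by (auto simp: indices_def)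
    have eq: "?V \<alpha> * partial (momentum \<alpha>) K \<beta> = ?V \<alpha> * partial (momentum \<alpha>) (coef q) \<beta>"
      if "(\<alpha>, \<beta>) \<in> splits \<gamma>" for \<alpha> \<beta>
    proof (cases "momentum \<alpha> = 0")
      case False
      have s: "\<alpha> + \<beta> = \<gamma>" using that by (simp add: splits_def)
      have "lk \<beta> 0 = 0" using \<gamma>(2) unfolding s[symmetric] by (simp add: lookup_add)
      moreover have M: "momentum \<beta> + momentum \<alpha> = 0"
        using \<gamma>(1) unfolding s[symmetric] by (simp add: momentum_add)
      then have "\<beta> \<noteq> 0" using False by auto
      then have "mdeg \<beta> > 0" by (metis mdeg_eq_0_iff neq0_conv)
      ultimately have "\<beta> + unit_idx (momentum \<alpha>) \<in> indices (mdeg \<beta> - 1)"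
        using M False by (simp add: indices_def mdeg_add momentum_add lookup_add lookup_single)
      then show ?thesis by (auto simp: partial_def K_def)
    qed (simp add: ham_field_def)
    have "poisson (dp_hamiltonian c) K \<gamma> = lie_deriv ?V K \<gamma>"
      by (rule poisson_eq_lie_deriv[OF dp_hamiltonian_formal_series K])
    also have "\<dots> = lie_deriv ?V (coef q) \<gamma>"
      unfolding lie_deriv_def by (intro sum.cong refl) (auto simp: eq)
    also have "\<dots> = coef (dp_flow c q) \<gamma>" by (simp add: flow_def)
    also have "\<dots> = 0" unfolding F using \<gamma> by simp
    finally show ?thesis .
  qed
  then have comm: "poisson (dp_hamiltonian c) K = 0" by (simp add: fun_eq_iff)
  have v2: "order_ge 2 (q * q)" "order_ge 2 (q * dx q)"
    using order_ge_mult[OF v v] order_ge_mult[OF v order_ge_dx[OF v]] by (simp_all add: numeral_2_eq_2)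
  have v3: "order_ge 3 (q ^ 3)"
    using order_ge_mult[OF v2(1) v] by (simp add: numeral_3_eq_3 mult.assoc)
  have q': "riccati_symbol \<kappa> (momentum \<alpha>) * coef q \<alpha> + 3 * coef (q * dx q) \<alpha> + 3 * of_real \<kappa> * coef (q * q) \<alpha>
      + coef (q ^ 3) \<alpha> + of_real \<mu> * coef w_series \<alpha> = 0" for \<alpha>
    using arg_cong[OF q, of "\<lambda>F. coef F \<alpha>"]
    unfolding mult.assoc[of 3] power2_eq_square coef_ring coef_riccati_linear coef_const_mult coef_numeral_mult
    by (simp add: mult.assoc)
  have w: "coef w_series \<alpha> = (1 + of_int (momentum \<alpha>) ^ 2) * coef u_series \<alpha>" for \<alpha>
    by (simp add: w_series_def power2_eq_square algebra_simps)
  have q1: "coef q (unit_idx j) = - (of_real \<mu> * (1 + of_int j ^ 2) / riccati_symbol \<kappa> j)" if "j \<noteq> 0" for j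
  proof -
    have "coef (q * dx q) (unit_idx j) = 0" "coef (q * q) (unit_idx j) = 0" "coef (q ^ 3) (unit_idx j) = 0"
      using v2 v3 by (auto simp: order_ge_def)
    moreover have "coef u_series (unit_idx j) = 1" using that by (auto simp: u_series_def)
    ultimately have "riccati_symbol \<kappa> j * coef q (unit_idx j) + of_real \<mu> * (1 + of_int j ^ 2) = 0"
      using q'[of "unit_idx j"] by (simp add: w)
    then show ?thesis using riccati_symbol_neq_0[OF assms(2), of j] by (simp add: field_simps eq_neg_iff_add_eq_0)
  qed
  define C where "C = - (6 * of_real (\<kappa> * \<mu> ^ 2) / riccati_symbol \<kappa> 0)"
  have "C \<noteq> 0" using assms(2) \<mu>(1) riccati_symbol_neq_0[OF assms(2), of 0] by (simp add: C_def)
  moreover have "K (unit_idx j + unit_idx (- j)) =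
      C * ((1 + of_int j ^ 2) ^ 2 / (riccati_symbol \<kappa> j * riccati_symbol \<kappa> (- j)))" if "j \<noteq> 0" for j
  proof -
    let ?\<alpha> = "unit_idx j + unit_idx (- j)"
    have M: "momentum ?\<alpha> = 0" by (simp add: momentum_add)
    have d: "mdeg ?\<alpha> = 2" by (simp add: mdeg_add)
    have "?\<alpha> \<in> indices 0" using that M d by (simp add: indices_def lookup_add lookup_single)
    then have "K ?\<alpha> = coef q ?\<alpha>" by (auto simp: K_def)
    have "coef (q * dx q) ?\<alpha> = 0"
    proof -
      have "coef (dx (q * q)) ?\<alpha> = 2 * coef (q * dx q) ?\<alpha>"
        unfolding dx_mult coef_ring by (simp add: mult.commute)
      then show ?thesis using M by simp
    qed
    moreover have "coef (q ^ 3) ?\<alpha> = 0" using v3 d by (simp add: order_ge_def)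
    moreover have "coef w_series ?\<alpha> = 0" using d by (auto simp: w u_series_def)
    moreover have "coef (q * q) ?\<alpha> = 2 * coef q (unit_idx j) * coef q (unit_idx (- j))"
    proof -
      have z: "lk (unit_idx (- j)) j = 0" using that by (simp add: lookup_single)
      have q0: "coef q 0 = 0" using v by (simp add: order_ge_def)
      have "coef (q * q) ?\<alpha> = partial j (coef (q * q)) (unit_idx (- j))"
        using z by (simp add: partial_def add.commute)
      also have "\<dots> = 2 * coef q (unit_idx j) * coef q (unit_idx (- j))"
        unfolding partial_mult splits_unit using that by (simp add: q0 partial_def)
      finally show ?thesis .
    qed
    ultimately have "riccati_symbol \<kappa> 0 * coef q ?\<alpha>
        + 3 * of_real \<kappa> * (2 * coef q (unit_idx j) * coef q (unit_idx (- j))) = 0"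
      using q'[of ?\<alpha>, unfolded M] by simp
    then have qa: "coef q ?\<alpha> = - (6 * of_real \<kappa> * coef q (unit_idx j) * coef q (unit_idx (- j)) / riccati_symbol \<kappa> 0)"
      using riccati_symbol_neq_0[OF assms(2), of 0] by (simp add: field_simps eq_neg_iff_add_eq_0)
    have "- j \<noteq> 0" using that by simp
    then show ?thesis
      unfolding \<open>K ?\<alpha> = coef q ?\<alpha>\<close> qa q1[OF that] q1[OF \<open>- j \<noteq> 0\<close>] C_def
      by (simp add: power2_eq_square mult_ac)
  qed
  ultimately show thesis using that K comm by blast
qed

section \<open>A conserved quantity without resonances\<close>

text \<open>
  Viewed as a polynomial in \<open>\<kappa>\<^sup>2\<close>, this is the denominator of the frequency of the mode \<open>j\<close>.
\<close>

definition pole_poly :: "int \<Rightarrow> complex poly" where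
  "pole_poly j = [:of_int ((1 + j ^ 2) ^ 2), of_int (3 * (j ^ 2 - 2)), 9:]"

lemma riccati_symbol_mult_riccati_symbol: "riccati_symbol \<kappa> j * riccati_symbol \<kappa> (- j) = poly (pole_poly j) (of_real (\<kappa> ^ 2))"
  by (simp add: riccati_symbol_def pole_poly_def algebra_simps power2_eq_square)

text \<open>
  If \<open>j\<^sup>2 \<noteq> k\<^sup>2\<close>, the difference of the two equations, divided by \<open>j\<^sup>2 - k\<^sup>2\<close>, gives
  \<open>3 z = - (2 + j\<^sup>2 + k\<^sup>2)\<close>, and at this point the polynomial of \<open>j\<close> is strictly positive.
\<close>

lemma pole_poly_common_root:
  assumes "poly (pole_poly j) z = 0" "poly (pole_poly k) z = 0"
  shows "j ^ 2 = k ^ 2"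
proof (rule ccontr)
  assume ne: "j ^ 2 \<noteq> k ^ 2"
  define a where "a = j ^ 2"
  define b where "b = k ^ 2"
  have ab: "a \<ge> 0" "b \<ge> 0" "a \<noteq> b" using ne by (auto simp: a_def b_def)
  have 1: "of_int ((1 + a) ^ 2) + z * (of_int (3 * (a - 2)) + z * 9) = 0"
    and 2: "of_int ((1 + b) ^ 2) + z * (of_int (3 * (b - 2)) + z * 9) = 0"
    using assms by (simp_all add: pole_poly_def a_def b_def)
  have "of_int (a - b) * (3 * z + of_int (2 + a + b)) =
      (of_int ((1 + a) ^ 2) + z * (of_int (3 * (a - 2)) + z * 9)) -
      (of_int ((1 + b) ^ 2) + z * (of_int (3 * (b - 2)) + z * 9))"
    by (simp add: algebra_simps power2_eq_square)
  then have "of_int (a - b) * (3 * z + of_int (2 + a + b)) = 0" using 1 2 by simp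
  then have "3 * z + of_int (2 + a + b) = 0" using ab(3) by (metis mult_eq_0_iff of_int_eq_0_iff right_minus_eq)
  then have z: "3 * z = - of_int (2 + a + b)" by (simp only: eq_neg_iff_add_eq_0)
  have "of_int ((1 + a) ^ 2) + z * (of_int (3 * (a - 2)) + z * 9) =
      of_int ((1 + a) ^ 2) + (3 * z) * of_int (a - 2) + (3 * z) * (3 * z)"
    by (simp add: algebra_simps)
  also have "\<dots> = of_int ((1 + a) ^ 2 + (2 + a + b) * (4 + b))"
    unfolding z by (simp add: algebra_simps power2_eq_square)
  finally have "(of_int ((1 + a) ^ 2 + (2 + a + b) * (4 + b)) :: complex) = 0" using 1 by simp
  then have "(1 + a) ^ 2 + (2 + a + b) * (4 + b) = 0" by (simp only: of_int_eq_0_iff)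
  moreover have "(2 + a + b) * (4 + b) > 0" using ab by simp
  ultimately show False using zero_le_power2[of "1 + a"] by linarith
qed

text \<open>
  Evaluate at a root of \<open>P i\<close>: all summands but the one of \<open>i\<close> contain the factor \<open>P i\<close>.
\<close>

lemma partial_fractions_independent:
  fixes P :: "'i \<Rightarrow> complex poly"
  assumes "finite J" "\<And>j. j \<in> J \<Longrightarrow> degree (P j) > 0"
    and "\<And>j k z. j \<in> J \<Longrightarrow> k \<in> J \<Longrightarrow> poly (P j) z = 0 \<Longrightarrow> poly (P k) z = 0 \<Longrightarrow> j = k"
    and "(\<Sum>j\<in>J. smult (b j) (\<Prod>k\<in>J - {j}. P k)) = 0" "i \<in> J"
  shows "b i = 0"
proof -
  have "\<not> constant (poly (P i))" using assms(2)[OF assms(5)] by (simp add: constant_degree)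
  then obtain z where z: "poly (P i) z = 0" using fundamental_theorem_of_algebra by blast
  have "(\<Sum>j\<in>J. b j * (\<Prod>k\<in>J - {j}. poly (P k) z)) = 0"
    using arg_cong[OF assms(4), of "\<lambda>p. poly p z"] by (simp add: poly_sum poly_prod)
  also have "(\<Sum>j\<in>J. b j * (\<Prod>k\<in>J - {j}. poly (P k) z)) =
      b i * (\<Prod>k\<in>J - {i}. poly (P k) z) + (\<Sum>j\<in>J - {i}. b j * (\<Prod>k\<in>J - {j}. poly (P k) z))"
    by (rule sum.remove[OF assms(1,5)])
  also have "(\<Sum>j\<in>J - {i}. b j * (\<Prod>k\<in>J - {j}. poly (P k) z)) = 0"
  proof (rule sum.neutral, rule ballI)
    fix j assume "j \<in> J - {i}"
    then have "(\<Prod>k\<in>J - {j}. poly (P k) z) = 0"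
      using assms(1,5) z by (intro prod_zero) auto
    then show "b j * (\<Prod>k\<in>J - {j}. poly (P k) z) = 0" by simp
  qed
  finally have "b i * (\<Prod>k\<in>J - {i}. poly (P k) z) = 0" by simp
  moreover have "(\<Prod>k\<in>J - {i}. poly (P k) z) \<noteq> 0"
    using assms(1,3,5) z by auto
  ultimately show ?thesis by simp
qed

lemma countable_mindex: "countable (UNIV :: mindex set)"
proof -
  have "\<alpha> \<in> range (\<lambda>js. \<Sum>j\<leftarrow>js. unit_idx j)" for \<alpha> :: mindex
  proof (induction "mdeg \<alpha>" arbitrary: \<alpha>)
    case 0
    then have "\<alpha> = (\<Sum>j\<leftarrow>[]. unit_idx j)" by simp
    then show ?case by (rule range_eqI)
  next
    case (Suc n)
    then have "\<alpha> \<noteq> 0" by auto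
    then obtain j where "lk \<alpha> j \<noteq> 0" by (metis lookup_zero poly_mapping_eqI)
    then obtain \<beta> where \<beta>: "\<alpha> = \<beta> + unit_idx j" by (rule idx_decompose)
    with Suc have "\<beta> \<in> range (\<lambda>js. \<Sum>j\<leftarrow>js. unit_idx j)" by (simp add: mdeg_add)
    then obtain js where "\<beta> = (\<Sum>j\<leftarrow>js. unit_idx j)" by blast
    then have "\<alpha> = (\<Sum>j\<leftarrow>j # js. unit_idx j)" by (simp add: \<beta> add.commute)
    then show ?case by (rule range_eqI)
  qed
  then have "UNIV = range (\<lambda>js::int list. \<Sum>j\<leftarrow>js. unit_idx j)" by blast
  then show ?thesis by (metis countable_image countableI_type)
qed

text \<open>
  The numerator, over the common denominator, of \<open>\<Sum>\<^sub>j \<omega>(j) h(j) \<alpha>\<^sub>j\<close>, where \<open>h(j)\<close> is the even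
  coefficient \<open>weight \<kappa> j\<close> defined below. As \<open>\<omega>\<close> is odd, the modes \<open>j\<close> and \<open>-j\<close> are collected.
\<close>

definition resonance_poly :: "mindex \<Rightarrow> complex poly" where
  "resonance_poly \<alpha> = (let J = {j. j > 0 \<and> (j \<in> Poly_Mapping.keys \<alpha> \<or> - j \<in> Poly_Mapping.keys \<alpha>)} in
     \<Sum>j\<in>J. smult ((of_nat (lk \<alpha> j) - of_nat (lk \<alpha> (- j))) * (of_real (omega j) * (1 + of_int j ^ 2) ^ 2))
       (\<Prod>k\<in>J - {j}. pole_poly k))"

lemma finite_pos_keys: "finite {j. j > 0 \<and> (j \<in> Poly_Mapping.keys \<alpha> \<or> - j \<in> Poly_Mapping.keys \<alpha>)}"
  for \<alpha> :: mindex
  by (rule finite_subset[of _ "Poly_Mapping.keys \<alpha> \<union> uminus ` Poly_Mapping.keys \<alpha>"])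
     (auto simp: image_iff, metis minus_minus)

lemma resonance_poly_eq_0:
  assumes "resonance_poly \<alpha> = 0"
  shows "lk \<alpha> j = lk \<alpha> (- j)"
proof -
  let ?J = "{j. j > 0 \<and> (j \<in> Poly_Mapping.keys \<alpha> \<or> - j \<in> Poly_Mapping.keys \<alpha>)}"
  have pos: "lk \<alpha> j = lk \<alpha> (- j)" if "j \<in> ?J" for j
  proof -
    have "(of_nat (lk \<alpha> j) - of_nat (lk \<alpha> (- j))) * (of_real (omega j) * (1 + of_int j ^ 2) ^ 2) = (0::complex)"
    proof (rule partial_fractions_independent[OF finite_pos_keys[of \<alpha>] _ _ _ that, where P = pole_poly])
      show "degree (pole_poly k) > 0" for k by (simp add: pole_poly_def)
      show "k = l" if "k \<in> ?J" "l \<in> ?J" "poly (pole_poly k) z = 0" "poly (pole_poly l) z = 0" for k l z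
        using pole_poly_common_root[OF that(3,4)] that(1,2) by (simp add: power2_eq_iff_nonneg)
    qed (use assms in \<open>simp only: resonance_poly_def Let_def\<close>)
    moreover have "(1 + of_int j ^ 2 :: complex) \<noteq> 0"
    proof -
      have "1 + j ^ 2 \<noteq> 0" using zero_le_power2[of j] by linarith
      then have "of_int (1 + j ^ 2) \<noteq> (0::complex)" by (simp only: of_int_eq_0_iff not_False_eq_True)
      then show ?thesis by simp
    qed
    ultimately show ?thesis using that by simp
  qed
  consider "j = 0" | "j \<in> ?J" | "- j \<in> ?J" | "lk \<alpha> j = 0 \<and> lk \<alpha> (- j) = 0"
    by (cases "lk \<alpha> j = 0 \<and> lk \<alpha> (- j) = 0"; cases "j > 0"; cases "j = 0") (auto simp: in_keys_iff)
  then show ?thesis using pos[of j] pos[of "- j"] by cases auto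
qed

text \<open>
  The coefficient of \<open>u\<^sub>j u\<^sub>-\<^sub>j\<close> in the quadratic part of the conserved series, up to a nonzero factor.
\<close>

definition weight :: "real \<Rightarrow> int \<Rightarrow> complex" where
  "weight \<kappa> j = (1 + of_int j ^ 2) ^ 2 / (riccati_symbol \<kappa> j * riccati_symbol \<kappa> (- j))"

lemma poly_resonance_poly:
  assumes "1 < \<kappa>" "(\<Sum>j\<in>Poly_Mapping.keys \<alpha>. of_real (omega j) * weight \<kappa> j * of_nat (lk \<alpha> j)) = 0"
  shows "poly (resonance_poly \<alpha>) (of_real (\<kappa> ^ 2)) = 0"
proof -
  let ?J = "{j. j > 0 \<and> (j \<in> Poly_Mapping.keys \<alpha> \<or> - j \<in> Poly_Mapping.keys \<alpha>)}"
  let ?P = "\<lambda>j. poly (pole_poly j) (of_real (\<kappa> ^ 2))"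
  let ?f = "\<lambda>j. of_real (omega j) * weight \<kappa> j * of_nat (lk \<alpha> j)"
  have fin: "finite ?J" by (rule finite_pos_keys)
  have nz: "?P j \<noteq> 0" for j
    unfolding riccati_symbol_mult_riccati_symbol[symmetric] using riccati_symbol_neq_0[OF assms(1)] by simp
  have "0 = (\<Sum>j\<in>?J \<union> uminus ` ?J. ?f j)"
    unfolding assms(2)[symmetric]
  proof (rule sum.mono_neutral_cong)
    show "?f j = 0" if "j \<in> Poly_Mapping.keys \<alpha> - (?J \<union> uminus ` ?J)" for j
    proof -
      have "\<not> j > 0" "\<not> j < 0" using that by (auto simp: image_iff) (metis minus_minus neg_0_less_iff_less)
      then show ?thesis by simp
    qed
  qed (use fin in \<open>auto simp: in_keys_iff\<close>)
  also have "\<dots> = (\<Sum>j\<in>?J. ?f j) + (\<Sum>j\<in>uminus ` ?J. ?f j)"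
    using fin by (intro sum.union_disjoint) auto
  also have "(\<Sum>j\<in>uminus ` ?J. ?f j) = (\<Sum>j\<in>?J. - of_real (omega j) * weight \<kappa> j * of_nat (lk \<alpha> (- j)))"
    by (subst sum.reindex) (auto simp: weight_def mult.commute intro!: sum.cong)
  finally have "0 = (\<Sum>j\<in>?J. ?f j + - of_real (omega j) * weight \<kappa> j * of_nat (lk \<alpha> (- j)))"
    unfolding sum.distrib .
  moreover have "?f j + - of_real (omega j) * weight \<kappa> j * of_nat (lk \<alpha> (- j)) =
      (of_nat (lk \<alpha> j) - of_nat (lk \<alpha> (- j))) * (of_real (omega j) * (1 + of_int j ^ 2) ^ 2) / ?P j" for j
    unfolding weight_def riccati_symbol_mult_riccati_symbol using nz[of j] by (simp add: field_simps)
  ultimately have 0: "(\<Sum>j\<in>?J. (of_nat (lk \<alpha> j) - of_nat (lk \<alpha> (- j))) *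
      (of_real (omega j) * (1 + of_int j ^ 2) ^ 2) / ?P j) = 0"
    by (simp only:)
  have "poly (resonance_poly \<alpha>) (of_real (\<kappa> ^ 2)) =
      (\<Sum>j\<in>?J. (of_nat (lk \<alpha> j) - of_nat (lk \<alpha> (- j))) * (of_real (omega j) * (1 + of_int j ^ 2) ^ 2)
        * (\<Prod>k\<in>?J - {j}. ?P k))"
    unfolding resonance_poly_def Let_def by (simp add: poly_sum poly_prod)
  also have "\<dots> = (\<Sum>j\<in>?J. (of_nat (lk \<alpha> j) - of_nat (lk \<alpha> (- j))) *
      (of_real (omega j) * (1 + of_int j ^ 2) ^ 2) / ?P j * (\<Prod>k\<in>?J. ?P k))"
  proof (rule sum.cong[OF refl])
    fix j assume "j \<in> ?J"
    with fin have "(\<Prod>k\<in>?J. ?P k) = ?P j * (\<Prod>k\<in>?J - {j}. ?P k)" by (rule prod.remove)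
    then show "(of_nat (lk \<alpha> j) - of_nat (lk \<alpha> (- j))) * (of_real (omega j) * (1 + of_int j ^ 2) ^ 2)
        * (\<Prod>k\<in>?J - {j}. ?P k) = (of_nat (lk \<alpha> j) - of_nat (lk \<alpha> (- j))) *
      (of_real (omega j) * (1 + of_int j ^ 2) ^ 2) / ?P j * (\<Prod>k\<in>?J. ?P k)"
      using nz[of j] by simp
  qed
  also have "\<dots> = 0" unfolding sum_distrib_right[symmetric] 0 by simp
  finally show ?thesis .
qed

text \<open>
  Each unbalanced multi-index excludes finitely many \<open>\<kappa>\<close>, namely those whose squares are roots of its
  nonzero resonance polynomial. There are countably many multi-indices and uncountably many \<open>\<kappa>\<close>.
\<close>

lemma nonresonant_kappa:
  obtains \<kappa> where "1 < \<kappa>"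
    "\<And>\<alpha> j. (\<Sum>j\<in>Poly_Mapping.keys \<alpha>. of_real (omega j) * weight \<kappa> j * of_nat (lk \<alpha> j)) = 0 \<Longrightarrow>
      lk \<alpha> j = lk \<alpha> (- j)"
proof -
  define bad where "bad = (\<lambda>\<alpha>. {\<kappa>. 1 < \<kappa> \<and> resonance_poly \<alpha> \<noteq> 0 \<and>
    poly (resonance_poly \<alpha>) (of_real (\<kappa> ^ 2)) = 0})"
  have "finite (bad \<alpha>)" for \<alpha>
  proof (cases "resonance_poly \<alpha> = 0")
    case False
    have inj: "inj_on (\<lambda>\<kappa>::real. complex_of_real (\<kappa> ^ 2)) {1<..}"
      unfolding inj_on_def of_real_eq_iff by (auto simp: power2_eq_iff)
    have "finite ((\<lambda>\<kappa>::real. complex_of_real (\<kappa> ^ 2)) -` {z. poly (resonance_poly \<alpha>) z = 0} \<inter> {1<..})"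
      by (rule finite_vimage_IntI[OF poly_roots_finite[OF False] inj])
    then show ?thesis by (rule finite_subset[rotated]) (auto simp: bad_def)
  qed (simp add: bad_def)
  then have "countable (\<Union>\<alpha>. bad \<alpha>)"
    using countable_mindex by (intro countable_UN) (auto intro: countable_finite)
  moreover have "uncountable {1<..<2::real}" by (simp add: uncountable_open_interval)
  ultimately have "\<not> {1<..<2} \<subseteq> (\<Union>\<alpha>. bad \<alpha>)" using countable_subset by blast
  then obtain \<kappa> where "\<kappa> \<in> {1<..<2}" "\<kappa> \<notin> (\<Union>\<alpha>. bad \<alpha>)" by blast
  then have \<kappa>: "1 < \<kappa>" "\<kappa> \<notin> bad \<alpha>" for \<alpha> by auto
  show thesis
  proof (rule that[OF \<kappa>(1)])
    fix \<alpha> j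
    assume "(\<Sum>j\<in>Poly_Mapping.keys \<alpha>. of_real (omega j) * weight \<kappa> j * of_nat (lk \<alpha> j)) = 0"
    from poly_resonance_poly[OF \<kappa>(1) this] \<kappa> have "resonance_poly \<alpha> = 0" by (auto simp: bad_def)
    then show "lk \<alpha> j = lk \<alpha> (- j)" by (rule resonance_poly_eq_0)
  qed
qed

section \<open>Leibniz rule and Jacobi identity\<close>

lemma poisson_add_left: "poisson (\<lambda>\<alpha>. P \<alpha> + P' \<alpha>) Q \<gamma> = poisson P Q \<gamma> + poisson P' Q \<gamma>"
  by (simp add: poisson_def sum.distrib[symmetric] case_prod_unfold algebra_simps)

lemma poisson_add_right: "poisson P (\<lambda>\<alpha>. Q \<alpha> + Q' \<alpha>) \<gamma> = poisson P Q \<gamma> + poisson P Q' \<gamma>"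
  by (simp add: poisson_def sum.distrib[symmetric] case_prod_unfold algebra_simps)

lemma poisson_sum_left:
  "poisson (\<lambda>\<alpha>. \<Sum>i\<in>I. a i * P i \<alpha>) Q \<gamma> = (\<Sum>i\<in>I. a i * poisson (P i) Q \<gamma>)"
  unfolding poisson_def sum_distrib_left sum_distrib_right
  by (subst sum.swap) (auto simp: sum_distrib_left case_prod_unfold mult_ac intro!: sum.cong)

lemma poisson_sum_right:
  "poisson P (\<lambda>\<alpha>. \<Sum>i\<in>I. a i * Q i \<alpha>) \<gamma> = (\<Sum>i\<in>I. a i * poisson P (Q i) \<gamma>)"
  unfolding poisson_def sum_distrib_left sum_distrib_right
  by (subst sum.swap) (auto simp: sum_distrib_left case_prod_unfold mult_ac intro!: sum.cong)

lemma poisson_antisym: "poisson P Q \<gamma> = - poisson Q P \<gamma>"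
proof -
  have swap: "(\<beta>, \<alpha>, - j) \<in> bracket_terms \<gamma>" if "(\<alpha>, \<beta>, j) \<in> bracket_terms \<gamma>" for \<alpha> \<beta> j
    using that by (auto simp: bracket_terms_def add.commute diff_diff_eq)
  show ?thesis
    unfolding poisson_def sum_negf[symmetric]
    by (rule sum.reindex_bij_witness[of _ "\<lambda>(\<alpha>, \<beta>, j). (\<beta>, \<alpha>, - j)" "\<lambda>(\<alpha>, \<beta>, j). (\<beta>, \<alpha>, - j)"])
       (auto dest: swap simp: mult_ac)
qed

lemma poisson_graded:
  assumes "P \<in> homog_ge m" "Q \<in> homog_ge n"
  shows "poisson P Q \<in> homog_ge (m + n)"
  unfolding homog_ge_def
proof (intro CollectI allI impI)
  fix \<gamma> assume "poisson P Q \<gamma> \<noteq> 0"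
  then obtain \<alpha> \<beta> j where t: "(\<alpha>, \<beta>, j) \<in> bracket_terms \<gamma>" and nz: "P \<alpha> \<noteq> 0" "Q \<beta> \<noteq> 0"
    unfolding poisson_def by (auto elim!: sum.not_neutral_contains_not_neutral)
  from nz(1) assms(1) obtain k where "k \<ge> m" "\<alpha> \<in> indices k" unfolding homog_ge_def by blast
  moreover from nz(2) assms(2) obtain l where "l \<ge> n" "\<beta> \<in> indices l"
    unfolding homog_ge_def by blast
  ultimately show "\<exists>k\<ge>m + n. \<gamma> \<in> indices k"
    using bracket_terms_indices[OF t] by (meson add_mono)
qed

lemma partial_lie_deriv:
  "partial j (lie_deriv V R) \<gamma> =
    (\<Sum>(\<alpha>, \<beta>)\<in>splits \<gamma>. partial j V \<alpha> * partial (momentum \<alpha> + j) R \<beta>) +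
    (\<Sum>(\<alpha>, \<beta>)\<in>splits \<gamma>. V \<alpha> * partial j (partial (momentum \<alpha>) R) \<beta>)"
  unfolding partial_def[of j "lie_deriv V R"] lie_deriv_def sum_splits_leibniz
  by (simp add: partial_def[of j] momentum_add mult_ac)

text \<open>
  The part of \<open>{P,{Q,R}}\<close> in which \<open>R\<close> is differentiated twice. It is symmetric in \<open>P\<close> and \<open>Q\<close>,
  because partial derivatives commute, and the Jacobi identity follows from this symmetry.
\<close>

definition second_order :: "fseries \<Rightarrow> fseries \<Rightarrow> fseries \<Rightarrow> mindex \<Rightarrow> complex" where
  "second_order P Q R \<gamma> = (\<Sum>(\<alpha>, \<rho>)\<in>splits \<gamma>. \<Sum>(\<beta>, \<epsilon>)\<in>splits \<rho>.
     ham_field P \<alpha> * ham_field Q \<beta> * partial (momentum \<alpha>) (partial (momentum \<beta>) R) \<epsilon>)"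

lemma second_order_commute: "second_order P Q R \<gamma> = second_order Q P R \<gamma>"
  unfolding second_order_def
  by (subst sum_splits_exchange) (simp add: partial_commute mult.commute[of "ham_field P _"])

text \<open>
  By the product rule, the outer bracket differentiates either \<open>R\<close> or \<open>Q\<close> a second time. The second
  case is the first one with \<open>Q\<close> and \<open>R\<close> exchanged; the sign comes from the oddness of \<open>\<omega>\<close>, as
  \<open>Q\<close> and \<open>R\<close> are differentiated at opposite frequencies.
\<close>

lemma poisson_poisson:
  assumes PQR: "P \<in> formal_series" "Q \<in> formal_series" "R \<in> formal_series" and \<gamma>: "momentum \<gamma> = 0"
  shows "poisson P (poisson Q R) \<gamma> = second_order P Q R \<gamma> - second_order P R Q \<gamma>"
proof -
  have 1: "(\<Sum>(\<beta>, \<epsilon>)\<in>splits \<rho>. partial (momentum \<alpha>) (ham_field Q) \<beta> * partial (momentum \<beta> + momentum \<alpha>) R \<epsilon>) =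
      - (\<Sum>(\<beta>, \<epsilon>)\<in>splits \<rho>. ham_field R \<beta> * partial (momentum \<alpha>) (partial (momentum \<beta>) Q) \<epsilon>)"
    if "(\<alpha>, \<rho>) \<in> splits \<gamma>" for \<alpha> \<rho>
  proof -
    have "partial (momentum \<alpha>) (ham_field Q) \<beta> * partial (momentum \<beta> + momentum \<alpha>) R \<epsilon> =
        - (ham_field R \<epsilon> * partial (momentum \<alpha>) (partial (momentum \<epsilon>) Q) \<beta>)"
      if "(\<beta>, \<epsilon>) \<in> splits \<rho>" for \<beta> \<epsilon>
    proof -
      have "momentum \<alpha> + (momentum \<beta> + momentum \<epsilon>) = 0"
        using that \<gamma> \<open>(\<alpha>, \<rho>) \<in> splits \<gamma>\<close> by (auto simp: splits_def momentum_add)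
      then have "momentum \<beta> + momentum \<alpha> = - momentum \<epsilon>" by simp
      then show ?thesis
        by (simp add: partial_def[of "momentum \<alpha>"] ham_field_def momentum_add)
    qed
    then have "(\<Sum>(\<beta>, \<epsilon>)\<in>splits \<rho>. partial (momentum \<alpha>) (ham_field Q) \<beta> * partial (momentum \<beta> + momentum \<alpha>) R \<epsilon>) =
        - (\<Sum>(\<beta>, \<epsilon>)\<in>splits \<rho>. ham_field R \<epsilon> * partial (momentum \<alpha>) (partial (momentum \<epsilon>) Q) \<beta>)"
      unfolding sum_negf[symmetric] by (intro sum.cong refl) auto
    then show ?thesis by (subst (2) sum_splits_swap)
  qed
  have eq: "poisson Q R = lie_deriv (ham_field Q) R"
    using poisson_eq_lie_deriv[OF PQR(2,3)] by (rule ext)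
  have "poisson P (poisson Q R) \<gamma> = (\<Sum>(\<alpha>, \<rho>)\<in>splits \<gamma>. ham_field P \<alpha> * partial (momentum \<alpha>) (poisson Q R) \<rho>)"
    using poisson_eq_lie_deriv[OF PQR(1) poisson_formal_series[OF PQR(2,3)]] by (simp add: lie_deriv_def)
  also have "\<dots> = (\<Sum>(\<alpha>, \<rho>)\<in>splits \<gamma>.
      ham_field P \<alpha> * (\<Sum>(\<beta>, \<epsilon>)\<in>splits \<rho>. ham_field Q \<beta> * partial (momentum \<alpha>) (partial (momentum \<beta>) R) \<epsilon>) -
      ham_field P \<alpha> * (\<Sum>(\<beta>, \<epsilon>)\<in>splits \<rho>. ham_field R \<beta> * partial (momentum \<alpha>) (partial (momentum \<beta>) Q) \<epsilon>))"
  proof (rule sum.cong[OF refl], clarify)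
    fix \<alpha> \<rho> assume \<rho>: "(\<alpha>, \<rho>) \<in> splits \<gamma>"
    show "ham_field P \<alpha> * partial (momentum \<alpha>) (poisson Q R) \<rho> =
      ham_field P \<alpha> * (\<Sum>(\<beta>, \<epsilon>)\<in>splits \<rho>. ham_field Q \<beta> * partial (momentum \<alpha>) (partial (momentum \<beta>) R) \<epsilon>) -
      ham_field P \<alpha> * (\<Sum>(\<beta>, \<epsilon>)\<in>splits \<rho>. ham_field R \<beta> * partial (momentum \<alpha>) (partial (momentum \<beta>) Q) \<epsilon>)"
      unfolding eq partial_lie_deriv 1[OF \<rho>] by (simp only: right_diff_distrib[symmetric] uminus_add_conv_diff)
  qed
  also have "\<dots> = second_order P Q R \<gamma> - second_order P R Q \<gamma>"
    unfolding second_order_def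
    by (simp add: sum_subtractf case_prod_unfold sum_distrib_left mult.assoc)
  finally show ?thesis .
qed

lemma poisson_jacobi:
  assumes "S \<in> formal_series" "F \<in> formal_series" "G \<in> formal_series"
  shows "poisson S (poisson F G) \<gamma> = poisson (poisson S F) G \<gamma> + poisson F (poisson S G) \<gamma>"
proof (cases "momentum \<gamma> = 0")
  case True
  have "poisson (poisson S F) G \<gamma> = - poisson G (poisson S F) \<gamma>" by (rule poisson_antisym)
  then show ?thesis
    using assms True
    by (simp add: poisson_poisson second_order_commute[of F S] second_order_commute[of G S]
        second_order_commute[of G F])
next
  case False
  have z: "P \<gamma> = 0" if "P \<in> formal_series" for P
    using that False by (auto simp: formal_series_def indices_def)
  have "poisson S (poisson F G) \<gamma> = 0" by (rule z) (intro poisson_formal_series assms)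
  moreover have "poisson (poisson S F) G \<gamma> = 0" by (rule z) (intro poisson_formal_series assms)
  moreover have "poisson F (poisson S G) \<gamma> = 0" by (rule z) (intro poisson_formal_series assms)
  ultimately show ?thesis by simp
qed

section \<open>Lie transforms\<close>

lemma homog_formal: "S \<in> homog m \<Longrightarrow> S \<in> formal_series"
  by (auto simp: homog_def formal_series_def)

lemma ad_formal:
  "S \<in> formal_series \<Longrightarrow> G \<in> formal_series \<Longrightarrow> (poisson S ^^ k) G \<in> formal_series"
  by (induction k) (simp_all add: poisson_formal_series)

lemma lie_transform_eq_sum:
  assumes "S \<in> homog m" "m \<ge> 1" "G \<in> formal_series" "mdeg \<alpha> \<le> n"
  shows "lie_transform S G \<alpha> = (\<Sum>k\<le>n. 1 / fact k * (poisson S ^^ k) G \<alpha>)"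
  unfolding lie_transform_def
proof (rule suminf_finite)
  fix k assume "k \<notin> {..n}"
  then have "mdeg \<alpha> < k * 1 + 2" using assms(4) by simp
  also have "\<dots> \<le> k * m + 2" using assms(2) by (intro add_right_mono mult_left_mono) auto
  finally show "1 / fact k * (poisson S ^^ k) G \<alpha> = 0"
    using ad_power_eq_0[OF assms(1,3)] by simp
qed simp

lemma lie_transform_formal:
  assumes "S \<in> homog m" "m \<ge> 1" "G \<in> formal_series"
  shows "lie_transform S G \<in> formal_series"
  unfolding formal_series_def
proof (intro CollectI allI impI)
  fix \<alpha> assume "lie_transform S G \<alpha> \<noteq> 0"
  then obtain k where "(poisson S ^^ k) G \<alpha> \<noteq> 0"
    unfolding lie_transform_eq_sum[OF assms order.refl]
    by (auto elim!: sum.not_neutral_contains_not_neutral)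
  then show "\<exists>n. \<alpha> \<in> indices n"
    using ad_formal[OF homog_formal[OF assms(1)] assms(3)] by (auto simp: formal_series_def)
qed

lemma indices_unique: "\<alpha> \<in> indices m \<Longrightarrow> \<alpha> \<in> indices n \<Longrightarrow> m = n"
  by (simp add: indices_def)

lemma homog_ge_below: "P \<in> homog_ge n \<Longrightarrow> \<alpha> \<in> indices k \<Longrightarrow> k < n \<Longrightarrow> P \<alpha> = 0"
  by (fastforce simp: homog_ge_def indices_def)

lemma lie_transform_below:
  assumes "S \<in> homog m" "m \<ge> 1" "G \<in> formal_series" "\<alpha> \<in> indices k" "k < m"
  shows "lie_transform S G \<alpha> = G \<alpha>"
proof -
  have "lie_transform S G \<alpha> = (\<Sum>i\<le>mdeg \<alpha>. 1 / fact i * (poisson S ^^ i) G \<alpha>)"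
    by (rule lie_transform_eq_sum[OF assms(1-3) order.refl])
  also have "\<dots> = (\<Sum>i\<in>{0}. 1 / fact i * (poisson S ^^ i) G \<alpha>)"
  proof (rule sum.mono_neutral_right)
    have "(poisson S ^^ i) G \<alpha> = 0" if "i \<ge> 1" for i
    proof (rule homog_ge_below[OF ad_power_homog_ge[OF assms(1,3)] assms(4)])
      have "1 * m \<le> i * m" using that by (rule mult_right_mono) simp
      with assms(5) show "k < i * m" by linarith
    qed
    then show "\<forall>i\<in>{..mdeg \<alpha>} - {0}. 1 / fact i * (poisson S ^^ i) G \<alpha> = 0" by simp
  qed auto
  finally show ?thesis by simp
qed

lemma lie_transform_at:
  assumes "S \<in> homog m" "m \<ge> 1" "G \<in> formal_series" "\<alpha> \<in> indices m"
  shows "lie_transform S G \<alpha> = G \<alpha> + poisson S G \<alpha>"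
proof -
  have "lie_transform S G \<alpha> = (\<Sum>i\<le>mdeg \<alpha>. 1 / fact i * (poisson S ^^ i) G \<alpha>)"
    by (rule lie_transform_eq_sum[OF assms(1-3) order.refl])
  also have "\<dots> = (\<Sum>i\<in>{0, 1}. 1 / fact i * (poisson S ^^ i) G \<alpha>)"
  proof (rule sum.mono_neutral_right)
    have "(poisson S ^^ i) G \<alpha> = 0" if "i \<ge> 2" for i
    proof (rule homog_ge_below[OF ad_power_homog_ge[OF assms(1,3)] assms(4)])
      have "2 * m \<le> i * m" using that by (rule mult_right_mono) simp
      with assms(2) show "m < i * m" by linarith
    qed
    then show "\<forall>i\<in>{..mdeg \<alpha>} - {0, 1}. 1 / fact i * (poisson S ^^ i) G \<alpha> = 0" by simp
    show "{0, 1} \<subseteq> {..mdeg \<alpha>}" using assms(4) by (auto simp: indices_def)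
  qed auto
  finally show ?thesis by simp
qed

text \<open>
  The higher Leibniz rule for the derivation \<open>{S, _}\<close> of the bracket.
\<close>

lemma ad_power_poisson:
  assumes "S \<in> formal_series" "F \<in> formal_series" "G \<in> formal_series"
  shows "(poisson S ^^ n) (poisson F G) \<gamma> =
    (\<Sum>k\<le>n. of_nat (n choose k) * poisson ((poisson S ^^ k) F) ((poisson S ^^ (n - k)) G) \<gamma>)"
proof (induction n arbitrary: \<gamma>)
  case (Suc n)
  define B where "B = (\<lambda>k l. poisson ((poisson S ^^ k) F) ((poisson S ^^ l) G))"
  have leib: "poisson S (B k l) \<gamma> = B (Suc k) l \<gamma> + B k (Suc l) \<gamma>" for k l
    unfolding B_def
    by (simp add: poisson_jacobi[OF assms(1) ad_formal[OF assms(1,2)] ad_formal[OF assms(1,3)]])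
  have "(poisson S ^^ n) (poisson F G) = (\<lambda>\<gamma>. \<Sum>k\<le>n. of_nat (n choose k) * B k (n - k) \<gamma>)"
    using Suc by (auto simp: B_def)
  then have "(poisson S ^^ Suc n) (poisson F G) \<gamma> = (\<Sum>k\<le>n. of_nat (n choose k) * poisson S (B k (n - k)) \<gamma>)"
    by (simp add: poisson_sum_right)
  also have "\<dots> = (\<Sum>k\<le>n. of_nat (n choose k) * B (Suc k) (n - k) \<gamma>) +
      (\<Sum>k\<le>n. of_nat (n choose k) * B k (Suc n - k) \<gamma>)"
    unfolding leib distrib_left sum.distrib by (simp add: Suc_diff_le)
  also have "(\<Sum>k\<le>n. of_nat (n choose k) * B k (Suc n - k) \<gamma>) =
      (\<Sum>k\<le>Suc n. of_nat (n choose k) * B k (Suc n - k) \<gamma>)" by simp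
  also have "\<dots> = B 0 (Suc n) \<gamma> + (\<Sum>k\<le>n. of_nat (n choose Suc k) * B (Suc k) (n - k) \<gamma>)"
    by (subst sum.atMost_Suc_shift) simp
  also have "(\<Sum>k\<le>n. of_nat (n choose k) * B (Suc k) (n - k) \<gamma>) +
      (B 0 (Suc n) \<gamma> + (\<Sum>k\<le>n. of_nat (n choose Suc k) * B (Suc k) (n - k) \<gamma>)) =
      (\<Sum>k\<le>Suc n. of_nat (Suc n choose k) * B k (Suc n - k) \<gamma>)"
    by (subst sum.atMost_Suc_shift) (simp add: sum.distrib distrib_right)
  finally show ?case by (simp add: B_def)
qed simp

text \<open>
  Exponentials of derivations are automorphisms. At a given monomial both exponential series may be
  truncated, after which the double sum of brackets is rearranged along the diagonals.
\<close>

lemma poisson_lie_transform_eq_0: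
  assumes S: "S \<in> homog m" "m \<ge> 1" and FG: "F \<in> formal_series" "G \<in> formal_series"
    and comm: "poisson F G = 0"
  shows "poisson (lie_transform S F) (lie_transform S G) = 0"
proof (rule ext)
  fix \<gamma>
  define n where "n = mdeg \<gamma>"
  define f where "f = (\<lambda>k. (poisson S ^^ k) F)"
  define g where "g = (\<lambda>k. (poisson S ^^ k) G)"
  define F' where "F' = (\<lambda>\<alpha>. \<Sum>k\<le>n. 1 / fact k * f k \<alpha>)"
  define G' where "G' = (\<lambda>\<alpha>. \<Sum>k\<le>n. 1 / fact k * g k \<alpha>)"
  let ?b = "\<lambda>k l. 1 / fact k * (1 / fact l * poisson (f k) (g l) \<gamma>)"
  have deg: "mdeg \<alpha> \<le> n \<and> mdeg \<beta> \<le> n" if t: "(\<alpha>, \<beta>, j) \<in> bracket_terms \<gamma>" for \<alpha> \<beta> j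
  proof -
    obtain k l where kl: "\<alpha> \<in> indices k" "\<beta> \<in> indices l" using t unfolding bracket_terms_def by blast
    from bracket_terms_indices[OF t kl] kl show ?thesis by (simp add: indices_def n_def)
  qed
  have "poisson (lie_transform S F) (lie_transform S G) \<gamma> = poisson F' G' \<gamma>"
    unfolding poisson_def
  proof (rule sum.cong[OF refl], clarify)
    fix \<alpha> \<beta> j assume "(\<alpha>, \<beta>, j) \<in> bracket_terms \<gamma>"
    note deg[OF this]
    then have "lie_transform S F \<alpha> = F' \<alpha>" "lie_transform S G \<beta> = G' \<beta>"
      using lie_transform_eq_sum[OF S FG(1), of \<alpha> n] lie_transform_eq_sum[OF S FG(2), of \<beta> n]
      by (simp_all add: F'_def G'_def f_def g_def)
    then show "- \<i> * of_real (omega j) * of_nat (lk \<alpha> j) * of_nat (lk \<beta> (- j))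
        * lie_transform S F \<alpha> * lie_transform S G \<beta> =
      - \<i> * of_real (omega j) * of_nat (lk \<alpha> j) * of_nat (lk \<beta> (- j)) * F' \<alpha> * G' \<beta>" by simp
  qed
  also have "\<dots> = (\<Sum>k\<le>n. \<Sum>l\<le>n. ?b k l)"
    unfolding F'_def G'_def poisson_sum_left poisson_sum_right sum_distrib_left ..
  also have "\<dots> = (\<Sum>(k, l)\<in>{..n} \<times> {..n}. ?b k l)" by (simp add: sum.cartesian_product)
  also have "\<dots> = (\<Sum>(k, l)\<in>{(k, l). k + l \<le> n}. ?b k l)"
  proof (rule sum.mono_neutral_right)
    have "k + l \<le> n" if "poisson (f k) (g l) \<gamma> \<noteq> 0" for k l
    proof -
      have "poisson (f k) (g l) \<in> homog_ge (k * m + l * m)"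
        unfolding f_def g_def by (intro poisson_graded ad_power_homog_ge S FG)
      with that obtain i where "i \<ge> k * m + l * m" "\<gamma> \<in> indices i" by (auto simp: homog_ge_def)
      moreover have "(k + l) * 1 \<le> (k + l) * m" using S(2) by (intro mult_left_mono) auto
      ultimately show ?thesis by (simp add: n_def indices_def algebra_simps)
    qed
    then show "\<forall>x\<in>{..n} \<times> {..n} - {(k, l). k + l \<le> n}. (case x of (k, l) \<Rightarrow> ?b k l) = 0" by auto
  qed auto
  also have "\<dots> = (\<Sum>r\<le>n. \<Sum>k\<le>r. ?b k (r - k))" by (rule sum.triangle_reindex_eq)
  also have "\<dots> = (\<Sum>r\<le>n. 1 / fact r * (poisson S ^^ r) (poisson F G) \<gamma>)"
    unfolding ad_power_poisson[OF homog_formal[OF S(1)] FG] sum_distrib_left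
    by (intro sum.cong refl) (simp add: f_def g_def binomial_fact)
  also have "\<dots> = 0"
  proof -
    have "poisson S 0 = 0" by (simp add: poisson_def fun_eq_iff)
    then have "(poisson S ^^ r) 0 = 0" for r by (induction r) auto
    then show ?thesis by (simp add: comm)
  qed
  finally show "poisson (lie_transform S F) (lie_transform S G) \<gamma> = 0 \<gamma>" by simp
qed

section \<open>Action-preserving series and the adjoint action of quadratic forms\<close>

text \<open>
  The involution \<open>j \<mapsto> -j\<close> on the terms of the bracket changes the sign of \<open>\<omega>(j)\<close> and nothing else.
\<close>

lemma poisson_action_preserving:
  assumes "action_preserving P" "action_preserving Q"
  shows "poisson P Q \<gamma> = 0"
proof -
  let ?t = "\<lambda>(\<alpha>, \<beta>, j). (- \<i>) * of_real (omega j) * of_nat (lk \<alpha> j)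
         * of_nat (lk \<beta> (- j)) * P \<alpha> * Q \<beta>"
  let ?B = "{(\<alpha>, \<beta>, j)\<in>bracket_terms \<gamma>. P \<alpha> \<noteq> 0 \<and> Q \<beta> \<noteq> 0}"
  have bal: "lk \<alpha> (- j) = lk \<alpha> j" "lk \<beta> (- j) = lk \<beta> j" if "P \<alpha> \<noteq> 0" "Q \<beta> \<noteq> 0" for \<alpha> \<beta> j
    using assms that unfolding action_preserving_def by metis+
  have "poisson P Q \<gamma> = sum ?t ?B"
    unfolding poisson_def by (rule sum.mono_neutral_right) (auto simp: finite_bracket_terms)
  also have "sum ?t ?B = sum (\<lambda>x. - ?t x) ?B"
    by (rule sum.reindex_bij_witness[of _ "\<lambda>(\<alpha>, \<beta>, j). (\<alpha>, \<beta>, - j)" "\<lambda>(\<alpha>, \<beta>, j). (\<alpha>, \<beta>, - j)"])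
       (auto simp: bal bracket_terms_def diff_diff_eq add.commute)
  also have "\<dots> = - sum ?t ?B" by (rule sum_negf)
  finally have "poisson P Q \<gamma> = - poisson P Q \<gamma>"
    using \<open>poisson P Q \<gamma> = sum ?t ?B\<close> by simp
  then show ?thesis by simp
qed

lemma mdeg_1E:
  assumes "mdeg \<alpha> = 1"
  obtains j where "\<alpha> = unit_idx j"
proof -
  from assms have "\<alpha> \<noteq> 0" by auto
  then obtain j where "lk \<alpha> j \<noteq> 0" by (metis lookup_zero poly_mapping_eqI)
  then obtain \<beta> where \<beta>: "\<alpha> = \<beta> + unit_idx j" by (rule idx_decompose)
  with assms have "\<beta> = 0" by (simp add: mdeg_add)
  with \<beta> show thesis using that by simp
qed

lemma indices_0_balanced:
  assumes "\<alpha> \<in> indices 0"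
  shows "lk \<alpha> j = lk \<alpha> (- j)"
proof -
  from assms have "\<alpha> \<noteq> 0" by (auto simp: indices_def)
  then obtain k where "lk \<alpha> k \<noteq> 0" by (metis lookup_zero poly_mapping_eqI)
  then obtain \<beta> where \<beta>: "\<alpha> = \<beta> + unit_idx k" by (rule idx_decompose)
  with assms have "mdeg \<beta> = 1" by (simp add: indices_def mdeg_add)
  then obtain l where "\<beta> = unit_idx l" by (rule mdeg_1E)
  moreover from this have "l = - k" using assms \<beta> by (simp add: indices_def momentum_add)
  ultimately show ?thesis using \<beta> by (auto simp: lookup_add lookup_single when_def)
qed

text \<open>
  For a quadratic form \<open>K = \<Sum> h(j) |u\<^sub>j|\<^sup>2\<close> (in terms of the coefficients of \<open>u\<^sub>j u\<^sub>-\<^sub>j\<close>) the monomial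
  \<open>u\<^sup>\<gamma>\<close> is an eigenvector of \<open>{K, _}\<close>, and this is its eigenvalue up to the factor \<open>i\<close>.
\<close>

definition detuning :: "fseries \<Rightarrow> mindex \<Rightarrow> complex" where
  "detuning K \<gamma> = (\<Sum>j\<in>Poly_Mapping.keys \<gamma>.
     of_real (omega j) * K (unit_idx j + unit_idx (- j)) * of_nat (lk \<gamma> j))"

lemma poisson_quadratic:
  assumes P: "P \<in> homog 0" and Q: "Q \<in> formal_series"
  shows "poisson P Q \<gamma> = \<i> * detuning P \<gamma> * Q \<gamma>"
proof -
  have P': "P \<in> formal_series" using P by (rule homog_formal)
  let ?h = "\<lambda>(\<alpha>, \<beta>). ham_field P \<alpha> * partial (momentum \<alpha>) Q \<beta>"
  let ?g = "\<lambda>j. (unit_idx j, \<gamma> - unit_idx j)"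
  have dec: "\<gamma> - unit_idx j + unit_idx j = \<gamma>" if "j \<in> Poly_Mapping.keys \<gamma>" for j
    using that by (intro poly_mapping_eqI) (auto simp: in_keys_iff lookup_add lookup_minus lookup_single when_def)
  have "poisson P Q \<gamma> = sum ?h (splits \<gamma>)"
    using poisson_eq_lie_deriv[OF P' Q] by (simp add: lie_deriv_def)
  also have "\<dots> = sum ?h (?g ` Poly_Mapping.keys \<gamma>)"
  proof (rule sum.mono_neutral_right)
    show "?g ` Poly_Mapping.keys \<gamma> \<subseteq> splits \<gamma>"
      using dec by (auto simp: splits_def add.commute)
    have "(\<alpha>, \<beta>) \<in> ?g ` Poly_Mapping.keys \<gamma>"
      if s: "\<alpha> + \<beta> = \<gamma>" and nz: "ham_field P \<alpha> \<noteq> 0" for \<alpha> \<beta>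
    proof -
      have "P (\<alpha> + unit_idx (- momentum \<alpha>)) \<noteq> 0" using nz by (auto simp: ham_field_def partial_def)
      then have "mdeg \<alpha> = 1" using P by (auto simp: homog_def indices_def mdeg_add)
      then obtain j where "\<alpha> = unit_idx j" by (rule mdeg_1E)
      with s show ?thesis by (intro image_eqI[of _ _ j]) (auto simp: in_keys_iff lookup_add)
    qed
    then show "\<forall>x\<in>splits \<gamma> - ?g ` Poly_Mapping.keys \<gamma>. ?h x = 0"
      by (fastforce simp: splits_def)
  qed simp
  also have "\<dots> = (\<Sum>j\<in>Poly_Mapping.keys \<gamma>. ?h (?g j))"
    by (subst sum.reindex) (auto simp: inj_on_def)
  also have "\<dots> = (\<Sum>j\<in>Poly_Mapping.keys \<gamma>.
      \<i> * (of_real (omega j) * P (unit_idx j + unit_idx (- j)) * of_nat (lk \<gamma> j)) * Q \<gamma>)"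
  proof (rule sum.cong[OF refl])
    fix j assume j: "j \<in> Poly_Mapping.keys \<gamma>"
    have "partial j Q (\<gamma> - unit_idx j) = of_nat (lk \<gamma> j) * Q \<gamma>"
    proof -
      have "Suc (lk (\<gamma> - unit_idx j) j) = lk \<gamma> j"
        using arg_cong[OF dec[OF j], of "\<lambda>\<gamma>. lk \<gamma> j"] by (simp add: lookup_add)
      then show ?thesis unfolding partial_def dec[OF j] by simp
    qed
    moreover have "ham_field P (unit_idx j) = \<i> * of_real (omega j) * P (unit_idx j + unit_idx (- j))"
      by (cases "j = 0") (simp_all add: ham_field_def partial_def lookup_single)
    ultimately show "?h (?g j) = \<i> * (of_real (omega j) * P (unit_idx j + unit_idx (- j)) * of_nat (lk \<gamma> j)) * Q \<gamma>"
      by simp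
  qed
  finally show ?thesis unfolding detuning_def sum_distrib_left sum_distrib_right .
qed

lemma component_homog: "component n G \<in> homog n"
  by (auto simp: component_def homog_def)

text \<open>
  In the lowest degree only the quadratic part of \<open>G\<close> contributes.
\<close>

lemma poisson_leading:
  assumes "P \<in> homog_ge s" "G \<in> formal_series" "\<gamma> \<in> indices s"
  shows "poisson P G \<gamma> = - (\<i> * detuning (component 0 G) \<gamma> * P \<gamma>)"
proof -
  define G1 where "G1 = (\<lambda>\<alpha>. if \<alpha> \<in> indices 0 then 0 else G \<alpha>)"
  have "G = (\<lambda>\<alpha>. component 0 G \<alpha> + G1 \<alpha>)" by (auto simp: component_def G1_def)
  then have "poisson P G \<gamma> = poisson P (component 0 G) \<gamma> + poisson P G1 \<gamma>"
    by (metis poisson_add_right)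
  moreover have "G1 \<in> homog_ge 1"
    using assms(2) unfolding homog_ge_def formal_series_def G1_def
    by (auto simp: Suc_le_eq) (metis neq0_conv)
  then have "poisson P G1 \<gamma> = 0"
    using homog_ge_below[OF poisson_graded[OF assms(1)] assms(3)] by simp
  moreover have "P \<in> formal_series" using assms(1) by (auto simp: homog_ge_def formal_series_def)
  then have "poisson (component 0 G) P \<gamma> = \<i> * detuning (component 0 G) \<gamma> * P \<gamma>"
    by (rule poisson_quadratic[OF component_homog])
  ultimately show ?thesis using poisson_antisym[of P "component 0 G" \<gamma>] by simp
qed

section \<open>Birkhoff normalisation through a commuting series\<close>

definition balanced_upto :: "nat \<Rightarrow> fseries \<Rightarrow> bool" where
  "balanced_upto n G \<longleftrightarrow> (\<forall>k\<le>n. \<forall>\<alpha>\<in>indices k. G \<alpha> \<noteq> 0 \<longrightarrow> (\<forall>j. lk \<alpha> j = lk \<alpha> (- j)))"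

lemma lie_composition_cong:
  "(\<And>k. 1 \<le> k \<Longrightarrow> k \<le> n \<Longrightarrow> S k = S' k) \<Longrightarrow> lie_composition S n G = lie_composition S' n G"
  by (induction n) simp_all

lemma lie_composition_formal:
  assumes "\<forall>k\<in>{1..n}. S k \<in> homog k" "G \<in> formal_series"
  shows "lie_composition S n G \<in> formal_series"
    and "component 0 (lie_composition S n G) = component 0 G"
proof -
  have "lie_composition S n G \<in> formal_series \<and>
      component 0 (lie_composition S n G) = component 0 G"
    using assms
  proof (induction n)
    case (Suc n)
    then have *: "lie_composition S n G \<in> formal_series" "S (Suc n) \<in> homog (Suc n)" 
      "component 0 (lie_composition S n G) = component 0 G" by auto
    have "component 0 (lie_transform (S (Suc n)) (lie_composition S n G)) = component 0 (lie_composition S n G)"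
      using lie_transform_below[OF *(2) _ *(1), of _ 0] by (auto simp: component_def fun_eq_iff)
    with * lie_transform_formal[OF *(2) _ *(1)] show ?case by simp
  qed simp
  then show "lie_composition S n G \<in> formal_series"
    and "component 0 (lie_composition S n G) = component 0 G" by auto
qed

text \<open>
  The usual Birkhoff step: the generator of degree \<open>n + 1\<close> removes exactly the monomials of \<open>K\<close> of this
  degree that are not action-preserving, on which the quadratic part of \<open>K\<close> acts by nonzero eigenvalues.
\<close>

lemma birkhoff_normalisation:
  assumes K: "K \<in> formal_series"
    and nonres: "\<And>n \<gamma> j. \<gamma> \<in> indices n \<Longrightarrow> detuning (component 0 K) \<gamma> = 0 \<Longrightarrow> lk \<gamma> j = lk \<gamma> (- j)"
  shows "\<exists>S. (\<forall>k\<in>{1..N}. S k \<in> homog k) \<and> balanced_upto N (lie_composition S N K)"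
proof (induction N)
    case 0
    show ?case by (auto simp: balanced_upto_def intro: indices_0_balanced)
  next
    case (Suc n)
    then obtain S where S: "\<forall>k\<in>{1..n}. S k \<in> homog k" "balanced_upto n (lie_composition S n K)" by blast
    define G where "G = lie_composition S n K"
    have G: "G \<in> formal_series" "component 0 G = component 0 K" using lie_composition_formal[OF S(1) K] by (auto simp: G_def)
    \<comment> \<open>The solution of the homological equation \<open>{\<eta>, K\<^sup>(\<^sup>0\<^sup>)} = -\<close> (unbalanced part of \<open>G\<close> in this degree).\<close>
    define \<eta> where "\<eta> = (\<lambda>\<gamma>. if \<gamma> \<in> indices (Suc n) \<and> \<not> (\<forall>j. lk \<gamma> j = lk \<gamma> (- j))
      then G \<gamma> / (\<i> * detuning (component 0 K) \<gamma>) else 0)"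
    have \<eta>: "\<eta> \<in> homog (Suc n)" by (auto simp: \<eta>_def homog_def)
    define S' where "S' = S(Suc n := \<eta>)"
    have "lie_composition S' n K = G"
      unfolding G_def by (rule lie_composition_cong) (simp add: S'_def)
    then have lc': "lie_composition S' (Suc n) K = lie_transform \<eta> G" by (simp add: S'_def)
    have "balanced_upto (Suc n) (lie_transform \<eta> G)"
      unfolding balanced_upto_def
    proof (intro allI impI ballI)
      fix k \<alpha> j
      assume k: "k \<le> Suc n" and \<alpha>: "\<alpha> \<in> indices k" and nz: "lie_transform \<eta> G \<alpha> \<noteq> 0"
      show "lk \<alpha> j = lk \<alpha> (- j)"
      proof (cases "k = Suc n")
        case False
        then have "lie_transform \<eta> G \<alpha> = G \<alpha>"
          using k by (intro lie_transform_below[OF \<eta> _ G(1) \<alpha>]) auto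
        moreover from False k have "k \<le> n" by simp
        ultimately show ?thesis using S(2) \<alpha> nz unfolding balanced_upto_def G_def[symmetric] by metis
      next
        case True
        have "\<eta> \<in> homog_ge (Suc n)" using \<eta> by (auto simp: homog_def homog_ge_def)
        then have "lie_transform \<eta> G \<alpha> = G \<alpha> - \<i> * detuning (component 0 K) \<alpha> * \<eta> \<alpha>"
          using lie_transform_at[OF \<eta> _ G(1)] \<alpha> True poisson_leading[of \<eta> "Suc n" G \<alpha>] G by simp
        with nz have "\<not> (\<eta> \<alpha> = G \<alpha> / (\<i> * detuning (component 0 K) \<alpha>) \<and> detuning (component 0 K) \<alpha> \<noteq> 0)"
          by (auto split: if_splits)
        moreover have "\<eta> \<alpha> = G \<alpha> / (\<i> * detuning (component 0 K) \<alpha>)" if "lk \<alpha> j \<noteq> lk \<alpha> (- j)"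
          using that \<alpha> True unfolding \<eta>_def by auto
        ultimately show ?thesis using nonres[OF \<alpha>, of j] by blast
      qed
    qed
    then have "balanced_upto (Suc n) (lie_composition S' (Suc n) K)" unfolding lc' .
    moreover have "\<forall>k\<in>{1..Suc n}. S' k \<in> homog k" using S(1) \<eta> by (simp add: S'_def)
    ultimately show ?case by (intro exI[of _ S'] conjI)
qed

lemma poisson_lie_composition_eq_0:
  assumes "\<forall>k\<in>{1..n}. S k \<in> homog k" "F \<in> formal_series" "G \<in> formal_series" "poisson F G = 0"
  shows "poisson (lie_composition S n F) (lie_composition S n G) = 0"
  using assms
proof (induction n)
  case (Suc n)
  then have S: "S (Suc n) \<in> homog (Suc n)" "\<forall>k\<in>{1..n}. S k \<in> homog k" by auto
  note lc = lie_composition_formal(1)[OF S(2)]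
  have "poisson (lie_composition S n F) (lie_composition S n G) = 0"
    by (rule Suc.IH[OF S(2) assms(2-4)])
  from poisson_lie_transform_eq_0[OF S(1) _ lc lc this] assms show ?case by simp
qed simp

text \<open>
  Being in normal form is inherited by whatever commutes with \<open>G\<close>. In degree \<open>s\<close> the relation
  \<open>{H, G} = 0\<close> contains brackets of components of \<open>H\<close> of lower degree with components of \<open>G\<close>, which
  vanish because both factors are action-preserving, and the bracket of the component of \<open>H\<close> of degree \<open>s\<close> with the quadratic part
  of \<open>G\<close>, which must then vanish too and forces that component to be action-preserving.
\<close>

lemma commuting_balanced:
  assumes H: "H \<in> formal_series" and G: "G \<in> formal_series" and comm: "poisson H G = 0"
    and bal: "balanced_upto N G"
    and nonres: "\<And>n \<gamma> j. \<gamma> \<in> indices n \<Longrightarrow> detuning (component 0 G) \<gamma> = 0 \<Longrightarrow> lk \<gamma> j = lk \<gamma> (- j)"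
  shows "balanced_upto N H"
proof -
  have "\<forall>\<gamma>\<in>indices s. H \<gamma> \<noteq> 0 \<longrightarrow> (\<forall>j. lk \<gamma> j = lk \<gamma> (- j))" if "s \<le> N" for s
    using that
  proof (induction s rule: less_induct)
    case (less s)
    define H1 where "H1 = (\<lambda>\<alpha>. if \<exists>k<s. \<alpha> \<in> indices k then H \<alpha> else 0)"
    define H2 where "H2 = (\<lambda>\<alpha>. if \<exists>k<s. \<alpha> \<in> indices k then 0 else H \<alpha>)"
    define G1 where "G1 = (\<lambda>\<alpha>. if \<exists>k\<le>s. \<alpha> \<in> indices k then G \<alpha> else 0)"
    define G2 where "G2 = (\<lambda>\<alpha>. if \<exists>k\<le>s. \<alpha> \<in> indices k then 0 else G \<alpha>)"
    have part: "x = (if b then x else 0) + (if b then 0 else x)" for b and x :: complex by simp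
    have split: "H = (\<lambda>\<alpha>. H1 \<alpha> + H2 \<alpha>)" "G = (\<lambda>\<alpha>. G1 \<alpha> + G2 \<alpha>)"
      unfolding H1_def H2_def G1_def G2_def by (rule ext, rule part)+
    have H1ap: "action_preserving H1"
      unfolding action_preserving_def
    proof (intro allI impI)
      fix \<alpha> j assume "H1 \<alpha> \<noteq> 0"
      then obtain k where "k < s" "\<alpha> \<in> indices k" "H \<alpha> \<noteq> 0" by (auto simp: H1_def split: if_splits)
      moreover from this less.prems have "k \<le> N" by simp
      ultimately show "lk \<alpha> j = lk \<alpha> (- j)" using less.IH by blast
    qed
    have G1ap: "action_preserving G1"
      unfolding action_preserving_def
    proof (intro allI impI)
      fix \<alpha> j assume "G1 \<alpha> \<noteq> 0"
      then obtain k where "k \<le> s" "\<alpha> \<in> indices k" "G \<alpha> \<noteq> 0" by (auto simp: G1_def split: if_splits)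
      moreover from this less.prems have "k \<le> N" by simp
      ultimately show "lk \<alpha> j = lk \<alpha> (- j)" using bal unfolding balanced_upto_def by blast
    qed
    have H1: "H1 \<in> homog_ge 0" by (auto simp: H1_def homog_ge_def)
    have H2: "H2 \<in> homog_ge s"
      using H unfolding homog_ge_def formal_series_def H2_def by (auto simp: not_less)
    have G2: "G2 \<in> homog_ge (Suc s)"
      using G unfolding homog_ge_def formal_series_def G2_def by (auto simp: Suc_le_eq) (metis not_less)
    show ?case
    proof (intro ballI impI allI)
      fix \<gamma> j assume \<gamma>: "\<gamma> \<in> indices s" and nz: "H \<gamma> \<noteq> 0"
      have "0 = poisson H G \<gamma>" by (simp add: comm)
      also have "\<dots> = poisson H1 G \<gamma> + poisson H2 G \<gamma>"
        by (subst split(1)) (rule poisson_add_left)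
      also have "poisson H1 G \<gamma> = poisson H1 G1 \<gamma> + poisson H1 G2 \<gamma>"
        by (subst split(2)) (rule poisson_add_right)
      also have "poisson H1 G1 \<gamma> = 0" by (rule poisson_action_preserving[OF H1ap G1ap])
      also have "poisson H1 G2 \<gamma> = 0"
        by (rule homog_ge_below[OF poisson_graded[OF H1 G2] \<gamma>]) simp
      also have "poisson H2 G \<gamma> = - (\<i> * detuning (component 0 G) \<gamma> * H2 \<gamma>)"
        by (rule poisson_leading[OF H2 G \<gamma>])
      also have "H2 \<gamma> = H \<gamma>" using \<gamma> indices_unique by (fastforce simp: H2_def)
      finally have "detuning (component 0 G) \<gamma> = 0" using nz by simp
      then show "lk \<gamma> j = lk \<gamma> (- j)" by (rule nonres[OF \<gamma>])
    qed
  qed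
  then show ?thesis unfolding balanced_upto_def by blast
qed

theorem theorem1p6:
  fixes c :: real and N :: nat
  assumes "c \<noteq> 0"
  shows "\<exists>\<Phi> \<in> formal_symplectic N. \<exists>Z \<in> homog_le N. \<exists>R \<in> homog_ge (N + 1).
           \<Phi> (dp_hamiltonian c) = component 0 (dp_hamiltonian c) + Z + R \<and>
           action_preserving Z \<and>
           poisson (component 0 (dp_hamiltonian c)) Z = 0"
proof -
  let ?H = "dp_hamiltonian c"
  obtain \<kappa> where \<kappa>: "1 < \<kappa>"
    "\<And>\<alpha> j. (\<Sum>j\<in>Poly_Mapping.keys \<alpha>. of_real (omega j) * weight \<kappa> j * of_nat (lk \<alpha> j)) = 0 \<Longrightarrow>
      lk \<alpha> j = lk \<alpha> (- j)"
    using nonresonant_kappa by blast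
  obtain K C where K: "K \<in> formal_series" "poisson ?H K = 0" "C \<noteq> 0"
    and quad: "\<And>j. j \<noteq> 0 \<Longrightarrow> K (unit_idx j + unit_idx (- j)) = C * weight \<kappa> j"
    using dp_conserved_series[OF assms \<kappa>(1)] unfolding weight_def by blast
  have nonres: "lk \<gamma> j = lk \<gamma> (- j)"
    if "\<gamma> \<in> indices n" "detuning (component 0 K) \<gamma> = 0" for n \<gamma> j
  proof (rule \<kappa>(2))
    have "component 0 K (unit_idx k + unit_idx (- k)) = C * weight \<kappa> k" if "k \<noteq> 0" for k
    proof -
      have "unit_idx k + unit_idx (- k) \<in> indices 0"
        using that by (simp add: indices_def mdeg_add momentum_add lookup_add lookup_single)
      then show ?thesis using quad[OF that] by (simp add: component_def)
    qed
    moreover have "k \<noteq> 0" if "k \<in> Poly_Mapping.keys \<gamma>" for k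
      using that \<open>\<gamma> \<in> indices n\<close> by (auto simp: indices_def in_keys_iff)
    ultimately have "detuning (component 0 K) \<gamma> =
        (\<Sum>k\<in>Poly_Mapping.keys \<gamma>. C * (of_real (omega k) * weight \<kappa> k * of_nat (lk \<gamma> k)))"
      unfolding detuning_def by (intro sum.cong refl) (simp add: mult_ac)
    then show "(\<Sum>k\<in>Poly_Mapping.keys \<gamma>. of_real (omega k) * weight \<kappa> k * of_nat (lk \<gamma> k)) = 0"
      using that(2) K(3) by (simp add: sum_distrib_left[symmetric])
  qed
  have "\<exists>S. (\<forall>k\<in>{1..N}. S k \<in> homog k) \<and> balanced_upto N (lie_composition S N K)"
  proof (rule birkhoff_normalisation[OF K(1)])
    fix n \<gamma> j assume "\<gamma> \<in> indices n" "detuning (component 0 K) \<gamma> = 0"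
    then show "lk \<gamma> j = lk \<gamma> (- j)" by (rule nonres)
  qed
  then obtain S where S: "\<forall>k\<in>{1..N}. S k \<in> homog k" "balanced_upto N (lie_composition S N K)"
    by (elim exE conjE)
  define H' where "H' = lie_composition S N ?H"
  have H': "H' \<in> formal_series" "component 0 H' = component 0 ?H"
    unfolding H'_def using lie_composition_formal[OF S(1) dp_hamiltonian_formal_series] by auto
  have bal: "balanced_upto N H'"
  proof (rule commuting_balanced[OF H'(1) lie_composition_formal(1)[OF S(1) K(1)] _ S(2)])
    show "poisson H' (lie_composition S N K) = 0"
      unfolding H'_def
      by (rule poisson_lie_composition_eq_0[OF S(1) dp_hamiltonian_formal_series K(1,2)])
    fix n \<gamma> j
    assume "\<gamma> \<in> indices n" "detuning (component 0 (lie_composition S N K)) \<gamma> = 0"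
    then show "lk \<gamma> j = lk \<gamma> (- j)"
      unfolding lie_composition_formal(2)[OF S(1) K(1)] by (rule nonres)
  qed
  define Z where "Z = (\<lambda>\<alpha>. if \<exists>k\<in>{1..N}. \<alpha> \<in> indices k then H' \<alpha> else 0)"
  define R where "R = (\<lambda>\<alpha>. if \<exists>k\<le>N. \<alpha> \<in> indices k then 0 else H' \<alpha>)"
  have "H' = component 0 H' + Z + R"
  proof (rule ext)
    fix \<alpha>
    have "(\<exists>k\<le>N. \<alpha> \<in> indices k) \<longleftrightarrow> \<alpha> \<in> indices 0 \<or> (\<exists>k\<in>{1..N}. \<alpha> \<in> indices k)"
      by (metis atLeastAtMost_iff less_one linorder_not_less zero_le)
    moreover have "\<not> (\<alpha> \<in> indices 0 \<and> (\<exists>k\<in>{1..N}. \<alpha> \<in> indices k))"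
      using indices_unique by fastforce
    ultimately show "H' \<alpha> = (component 0 H' + Z + R) \<alpha>"
      by (auto simp: component_def Z_def R_def)
  qed
  moreover have "Z \<in> homog_le N" by (auto simp: Z_def homog_le_def)
  moreover have "R \<in> homog_ge (N + 1)"
    using H'(1) unfolding homog_ge_def formal_series_def R_def
    by (auto simp: Suc_le_eq) (metis not_less)
  moreover have ap: "action_preserving Z"
    unfolding action_preserving_def
  proof (intro allI impI)
    fix \<alpha> j assume "Z \<alpha> \<noteq> 0"
    then obtain k where "k \<le> N" "\<alpha> \<in> indices k" "H' \<alpha> \<noteq> 0" by (auto simp: Z_def split: if_splits)
    then show "lk \<alpha> j = lk \<alpha> (- j)" using bal unfolding balanced_upto_def by blast
  qed
  moreover have "poisson (component 0 ?H) Z = 0"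
  proof -
    have "action_preserving (component 0 ?H)"
      by (auto simp: action_preserving_def component_def intro: indices_0_balanced)
    then show ?thesis using poisson_action_preserving[OF _ ap] by (simp add: fun_eq_iff)
  qed
  moreover have "lie_composition S N \<in> formal_symplectic N"
    using S(1) by (auto simp: formal_symplectic_def)
  ultimately show ?thesis
    using H'(2) unfolding H'_def by metis
qed

end
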